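(* (i) For any $x\in\mathcal{X}$, $$\mathbb{E}\left[E_x\left[T_{\rho(\Phi_Q)}\right]\right]=\sum_{y\in\mathcal{X}}\frac{1}{q(y)}\left[\mathbb{P}\left(\rho(\tau_x(\Phi_Q))=\{y\}\right)-\mathbb{P}\left(\rho(\Phi_Q)=\{y\}\right)\right],$$ with $\tau_x(\Phi_Q)$ the unique tree in $\Phi_Q$ containing $x$, and with $1/q(y)=0$ when $q(y)=+\infty$. (ii) In the standard case $q(x)\equiv q>0$, this reduces to: for any $x\in\mathcal{X}$, $$\mathbb{E}\left[E_x\left[T_{\rho(\Phi_q)}\right]\right]=\frac1q\left[1-\mathbb{P}\left(|\rho(\Phi_q)|=1\right)\right]=\frac1q\left(1-\prod_{i=1}^{n-1}\frac{\lambda_i}{q+\lambda_i}\right).$$ (iii) Moreover, for $1\le m<n$ and any $x\in\mathcal{X}$, $$\mathbb{E}\left[E_x\left[T_{\rho(\Phi_q)}\right]\,\Big|\,|\rho(\Phi_q)|=m\right]=\frac{\mathbb{P}(|\rho(\Phi_q)|=m+1)}{q\,\mathbb{P}(|\rho(\Phi_q)|=m)}=\frac{a_{m+1}}{a_m},$$ where $a_k$ is the coefficient of degree $k$ in the characteristic polynomial $\det(q-L)=a_1q+\cdots+q^n$ (a polynomial in $q$).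
   Context: Let $X$ be an irreducible continuous-time Markov process on a finite set $\mathcal{X}$, $|\mathcal{X}|=n$, with generator $(Lf)(x)=\sum_{y\in\mathcal{X}}w(x,y)[f(y)-f(x)]$, where the rates $w(x,y)\in[0,\infty)$ are given. $E_x$ denotes expectation for $X$ started from $x$. The matrix of $L$ is also denoted $L$; $\det(q-L)$ means $\det(q\mathbf{1}-L)$ with $\mathbf{1}$ the identity matrix, and $\lambda_0=0,\lambda_1,\dots,\lambda_{n-1}$ are the (possibly complex) eigenvalues of $-L$, with multiplicity, ordered by non-decreasing real part. Let $\mathcal{E}=\{(x,y)\in\mathcal{X}\times\mathcal{X}: x\neq y,\ w(x,y)>0\}$ and $w(e)=w(x,y)$ for $e=(x,y)\in\mathcal{E}$. A spanning rooted forest is obtained from an undirected simple acyclic graph with vertex set $\mathcal{X}$ by choosing one root in each connected component (tree) and orienting the edges of each tree towards its root; it is identified with its set of oriented edges. $\mathcal{F}$ is the set of spanning rooted forests all of whose oriented edges lie in $\mathcal{E}$. For $\phi\in\mathcal{F}$, $\rho(\phi)\subset\mathcal{X}$ is the set of roots and $w(\phi)=\prod_{e\in\phi}w(e)$. For $x\in\mathcal{X}$, $\tau_x(\phi)$ is the tree of $\phi$ containing $x$, and $\rho(\tau_x(\phi))=\{y\}$ means that this tree has root $y$. Killing rates $q(x)\in[0,\infty]$, $x\in\mathcal{X}$, are given, with $q(x)>0$ for at least one $x$. $Q$ is the diagonal matrix with entries $q(x)$, $S=\{x:q(x)=+\infty\}$, $w_Q(\phi)=w(\phi)\prod_{x\in\rho(\phi)\setminus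 S}q(x)\,\mathbf{1}_{\{S\subset\rho(\phi)\}}$, $Z_Q=\sum_{\phi\in\mathcal{F}}w_Q(\phi)$, $\nu_Q=w_Q/Z_Q$; $\Phi_Q$ is a random forest with law $\nu_Q$ under $\mathbb{P}$ (with expectation $\mathbb{E}$). When $q(x)\equiv q\in(0,\infty)$ one writes $\Phi_q$; its law is proportional to $q^{|\rho(\phi)|}w(\phi)$. For $R\subset\mathcal{X}$, $T_R=\inf\{t\ge0:X(t)\in R\}$. In $\mathbb{E}[E_x[T_{\rho(\Phi_Q)}]]$ the inner expectation is over $X$ with the root set fixed and the outer one is over $\Phi_Q$.
   Formalization: In (i), where q(y)=0 is allowed but 1/q(y) is undefined (reading the term as 0 makes the formula false), the term for y is taken as its limit as q(y) decreases to 0 with the other rates fixed; if all q(y)>0 the formula is unchanged. *)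

theory Defs
  imports "HOL-Probability.Probability" "HOL-Computational_Algebra.Computational_Algebra"
begin

section \<open>The Markov process\<close>

text \<open>
  The state space is the finite type \<open>'a\<close>, so that \<open>n = CARD('a)\<close>. The values \<open>w x x\<close> are
  irrelevant: they occur neither in the generator nor in the edge set.
\<close>

definition generator :: "('a::finite \<Rightarrow> 'a \<Rightarrow> real) \<Rightarrow> real ^ 'a \<Rightarrow> real ^ 'a" where
  "generator w f = (\<chi> x. \<Sum>y\<in>UNIV. w x y * (f $ y - f $ x))"

definition gen_matrix :: "('a::finite \<Rightarrow> 'a \<Rightarrow> real) \<Rightarrow> real ^ 'a ^ 'a" where
  "gen_matrix w = matrix (generator w)"

definition edges :: "('a \<Rightarrow> 'a \<Rightarrow> real) \<Rightarrow> ('a \<times> 'a) set" where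
  "edges w = {(x, y). x \<noteq> y \<and> w x y > 0}"

definition irreducible_rates :: "('a \<Rightarrow> 'a \<Rightarrow> real) \<Rightarrow> bool" where
  "irreducible_rates w \<longleftrightarrow> (\<forall>x y. (x, y) \<in> (edges w)\<^sup>*)"

text \<open>
  The type class power \<open>A ^ k\<close> on \<open>real ^ 'a ^ 'a\<close> is componentwise; the matrix power has to be
  spelled out.
\<close>

definition matrix_exp :: "real ^ 'a ^ 'a \<Rightarrow> real ^ 'a ^ 'a" where
  "matrix_exp A = (\<Sum>k. (1 / fact k) *\<^sub>R ((\<lambda>B. A ** B) ^^ k) (mat 1))"

text \<open>
  \<open>X\<close> is, under \<open>M\<close>, a continuous-time Markov process with right-continuous paths (for the discrete
  topology on \<open>'a\<close>), started from \<open>x\<close>, with transition semigroup \<open>exp (t L)\<close>. The Markov property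
  is expressed by the finite-dimensional distributions; the case \<open>k = 0\<close> says that \<open>X 0 = x\<close>
  almost surely.
\<close>

definition markov_process_from ::
    "('a::finite \<Rightarrow> 'a \<Rightarrow> real) \<Rightarrow> 'a \<Rightarrow> 'w measure \<Rightarrow> (real \<Rightarrow> 'w \<Rightarrow> 'a) \<Rightarrow> bool" where
  "markov_process_from w x M X \<longleftrightarrow>
     prob_space M \<and>
     (\<forall>t\<ge>0. X t \<in> measurable M (count_space UNIV)) \<and>
     (\<forall>\<omega>\<in>space M. \<forall>t\<ge>0. \<forall>\<^sub>F s in at_right t. X s \<omega> = X t \<omega>) \<and>
     (\<forall>k (t :: nat \<Rightarrow> real) z.
        t 0 = 0 \<longrightarrow> (\<forall>i<k. t i \<le> t (Suc i)) \<longrightarrow>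
        \<P>(\<omega> in M. \<forall>i\<le>k. X (t i) \<omega> = z i) =
          (if z 0 = x then 1 else 0) *
          (\<Prod>i<k. matrix_exp ((t (Suc i) - t i) *\<^sub>R gen_matrix w) $ z i $ z (Suc i)))"

definition hitting_time :: "(real \<Rightarrow> 'w \<Rightarrow> 'a) \<Rightarrow> 'a set \<Rightarrow> 'w \<Rightarrow> ennreal" where
  "hitting_time X R \<omega> = Inf (ennreal ` {t. 0 \<le> t \<and> X t \<omega> \<in> R})"

definition mean_hitting_time :: "'w measure \<Rightarrow> (real \<Rightarrow> 'w \<Rightarrow> 'a) \<Rightarrow> 'a set \<Rightarrow> ennreal" where
  "mean_hitting_time M X R = (\<integral>\<^sup>+ \<omega>. hitting_time X R \<omega> \<partial>M)"


section \<open>Characteristic polynomial and eigenvalues\<close>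

definition charpoly :: "'b::comm_ring_1 ^ 'n ^ 'n \<Rightarrow> 'b poly" where
  "charpoly A = det (mat [:0, 1:] - map_matrix (\<lambda>c. [:c:]) A)"

definition eigenvalue_enum :: "complex ^ 'n ^ 'n \<Rightarrow> (nat \<Rightarrow> complex) \<Rightarrow> bool" where
  "eigenvalue_enum A lam \<longleftrightarrow>
     (\<forall>z. card {i. i < CARD('n) \<and> lam i = z} = order z (charpoly A))"


section \<open>Spanning rooted forests\<close>

text \<open>
  An undirected simple graph on the vertex set \<open>UNIV\<close> is a symmetric irreflexive relation.
\<close>

definition simple_path :: "('a \<times> 'a) set \<Rightarrow> 'a list \<Rightarrow> bool" where
  "simple_path G p \<longleftrightarrow> p \<noteq> [] \<and> distinct p \<and> successively (\<lambda>u v. (u, v) \<in> G) p"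

definition undirected_acyclic :: "('a \<times> 'a) set \<Rightarrow> bool" where
  "undirected_acyclic G \<longleftrightarrow> sym G \<and> irrefl G \<and>
     \<not> (\<exists>c. length c \<ge> 3 \<and> simple_path G c \<and> (last c, hd c) \<in> G)"

definition root_choice :: "('a \<times> 'a) set \<Rightarrow> 'a set \<Rightarrow> bool" where
  "root_choice G R \<longleftrightarrow> (\<forall>x. \<exists>!r. r \<in> R \<and> (x, r) \<in> G\<^sup>*)"

text \<open>
  The edge between \<open>u\<close> and \<open>v\<close> is oriented from \<open>u\<close> to \<open>v\<close> if it is the first step of the path
  from \<open>u\<close> to the root of its tree.
\<close>

definition orient :: "('a \<times> 'a) set \<Rightarrow> 'a set \<Rightarrow> ('a \<times> 'a) set" where
  "orient G R = {(u, v). \<exists>p. simple_path G (u # v # p) \<and> last (u # v # p) \<in> R}"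

definition spanning_rooted_forests :: "('a \<times> 'a) set set" where
  "spanning_rooted_forests = {orient G R | G R. undirected_acyclic G \<and> root_choice G R}"

definition forests :: "('a \<Rightarrow> 'a \<Rightarrow> real) \<Rightarrow> ('a \<times> 'a) set set" where
  "forests w = {\<phi> \<in> spanning_rooted_forests. \<phi> \<subseteq> edges w}"

text \<open>
  The underlying graph and the chosen roots are recovered from the oriented edges, as proved in
  \<open>orient_Un_converse\<close> and \<open>roots_orient\<close> below.
\<close>

definition roots :: "('a \<times> 'a) set \<Rightarrow> 'a set" where
  "roots \<phi> = {x. \<forall>y. (x, y) \<notin> \<phi>}"

definition tree_of :: "('a \<times> 'a) set \<Rightarrow> 'a \<Rightarrow> 'a set" where
  "tree_of \<phi> x = {y. (x, y) \<in> (\<phi> \<union> \<phi>\<inverse>)\<^sup>*}"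

lemma rtrancl_simple_path:
  assumes "(x, y) \<in> G\<^sup>*"
  shows "\<exists>p. simple_path G p \<and> hd p = x \<and> last p = y"
  using assms
proof (induction rule: converse_rtrancl_induct)
  case base
  show ?case
    by (rule exI[of _ "[y]"]) (simp add: simple_path_def)
next
  case (step x z)
  then obtain p where p: "simple_path G p" "hd p = z" "last p = y"
    by blast
  show ?case
  proof (cases "x \<in> set p")
    case True
    then obtain p1 p2 where "p = p1 @ x # p2"
      by (meson split_list)
    with p have "simple_path G (x # p2) \<and> hd (x # p2) = x \<and> last (x # p2) = y"
      by (auto simp: simple_path_def successively_append_iff)
    then show ?thesis
      by blast
  next
    case False
    with p step.hyps have "simple_path G (x # p) \<and> hd (x # p) = x \<and> last (x # p) = y"
      by (auto simp: simple_path_def successively_Cons)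
    then show ?thesis
      by blast
  qed
qed

lemma simple_path_rtrancl:
  assumes "simple_path G p"
  shows "(hd p, last p) \<in> G\<^sup>*"
proof -
  have "p \<noteq> [] \<Longrightarrow> successively (\<lambda>u v. (u, v) \<in> G) p \<Longrightarrow> (hd p, last p) \<in> G\<^sup>*"
    by (induction p) (auto simp: successively_Cons intro: converse_rtrancl_into_rtrancl)
  with assms show ?thesis
    by (simp add: simple_path_def)
qed

lemma orient_Un_converse:
  assumes "undirected_acyclic G" "root_choice G R"
  shows "orient G R \<union> (orient G R)\<inverse> = G"
proof
  have "sym G"
    using assms by (simp add: undirected_acyclic_def)
  then show "orient G R \<union> (orient G R)\<inverse> \<subseteq> G"
    by (auto simp: orient_def simple_path_def) (meson symE)+
next
  show "G \<subseteq> orient G R \<union> (orient G R)\<inverse>"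
  proof (rule subrelI)
    fix u v assume uv: "(u, v) \<in> G"
    have ir: "u \<noteq> v"
      using assms(1) uv by (auto simp: undirected_acyclic_def irrefl_def)
    have vu: "(v, u) \<in> G"
      using assms(1) uv by (meson symE undirected_acyclic_def)
    obtain r where r: "r \<in> R" "(u, r) \<in> G\<^sup>*"
      using assms(2) unfolding root_choice_def by blast
    then obtain p where p: "simple_path G p" "hd p = u" "last p = r"
      using rtrancl_simple_path by metis
    then obtain p' where p': "p = u # p'"
      by (cases p) (auto simp: simple_path_def)
    show "(u, v) \<in> orient G R \<union> (orient G R)\<inverse>"
    proof (cases "v \<in> set p'")
      case False
      with p p' vu ir have "simple_path G (v # u # p')"
        by (simp add: simple_path_def)
      moreover have "last (v # u # p') \<in> R"
        using p p' r by simp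
      ultimately have "(v, u) \<in> orient G R"
        unfolding orient_def by blast
      then show ?thesis
        by blast
    next
      case True
      then obtain a b where ab: "p' = a @ v # b"
        by (meson split_list)
      show ?thesis
      proof (cases a)
        case Nil
        then have "simple_path G (u # v # b)" "last (u # v # b) \<in> R"
          using p p' ab r by simp_all
        then have "(u, v) \<in> orient G R"
          unfolding orient_def by blast
        then show ?thesis
          by blast
      next
        case (Cons c a')
        have "simple_path G (u # a @ [v])"
          using p p' ab unfolding simple_path_def
          by (auto simp: successively_Cons successively_append_iff hd_append)
        moreover have "(last (u # a @ [v]), hd (u # a @ [v])) \<in> G"
          using vu by simp
        moreover have "length (u # a @ [v]) \<ge> 3"
          using Cons by simp
        ultimately show ?thesis
          using assms(1) unfolding undirected_acyclic_def by blast
      qed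
    qed
  qed
qed

lemma roots_orient:
  assumes "root_choice G R"
  shows "roots (orient G R) = R"
proof
  show "roots (orient G R) \<subseteq> R"
  proof (rule ccontr)
    assume "\<not> roots (orient G R) \<subseteq> R"
    then obtain x where x: "x \<in> roots (orient G R)" "x \<notin> R"
      by blast
    obtain r where r: "r \<in> R" "(x, r) \<in> G\<^sup>*"
      using assms unfolding root_choice_def by blast
    then obtain p where p: "simple_path G p" "hd p = x" "last p = r"
      using rtrancl_simple_path by metis
    then obtain p0 where p0: "p = x # p0"
      by (cases p) (auto simp: simple_path_def)
    with p x r obtain v p' where "p = x # v # p'"
      by (cases p0) auto
    with p r have "simple_path G (x # v # p')" "last (x # v # p') \<in> R"
      by simp_all
    then have "(x, v) \<in> orient G R"
      unfolding orient_def by blast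
    with x show False
      by (auto simp: roots_def)
  qed
next
  show "R \<subseteq> roots (orient G R)"
  proof
    fix x assume x: "x \<in> R"
    show "x \<in> roots (orient G R)"
    proof (rule ccontr)
      assume "x \<notin> roots (orient G R)"
      then obtain v p where p: "simple_path G (x # v # p)" "last (x # v # p) \<in> R"
        by (auto simp: roots_def orient_def)
      have "(x, last (x # v # p)) \<in> G\<^sup>*"
        using simple_path_rtrancl[OF p(1)] by simp
      then have "last (x # v # p) = x"
        using assms x p(2) unfolding root_choice_def by blast
      moreover have "last (x # v # p) \<in> set (v # p)"
        by simp
      ultimately show False
        using p(1) unfolding simple_path_def by simp
    qed
  qed
qed


section \<open>The random forest\<close>

definition forest_weight :: "('a::finite \<Rightarrow> 'a \<Rightarrow> real) \<Rightarrow> ('a \<Rightarrow> ennreal) \<Rightarrow> ('a \<times> 'a) set \<Rightarrow> real" where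
  "forest_weight w Q \<phi> =
     (\<Prod>(x, y)\<in>\<phi>. w x y) * (\<Prod>x\<in>roots \<phi> - {x. Q x = \<infinity>}. enn2real (Q x)) *
     (if {x. Q x = \<infinity>} \<subseteq> roots \<phi> then 1 else 0)"

definition partition_function :: "('a::finite \<Rightarrow> 'a \<Rightarrow> real) \<Rightarrow> ('a \<Rightarrow> ennreal) \<Rightarrow> real" where
  "partition_function w Q = (\<Sum>\<phi>\<in>forests w. forest_weight w Q \<phi>)"

definition forest_law ::
    "('a::finite \<Rightarrow> 'a \<Rightarrow> real) \<Rightarrow> ('a \<Rightarrow> ennreal) \<Rightarrow> ('a \<times> 'a) set measure" where
  "forest_law w Q =
     point_measure (forests w) (\<lambda>\<phi>. ennreal (forest_weight w Q \<phi> / partition_function w Q))"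

text \<open>
  If \<open>Q y = 0\<close>, then both \<open>roots \<phi> \<inter> tree_of \<phi> x = {y}\<close> and \<open>roots \<phi> = {y}\<close> have probability 0, and
  the term \<open>1 / Q y * (\<P>(roots \<phi> \<inter> tree_of \<phi> x = {y}) - \<P>(roots \<phi> = {y}))\<close> of the formula for the
  mean hitting time has to be read as its limit as the rate at \<open>y\<close> decreases to 0, all other rates
  being fixed. It cannot be read as 0: if \<open>Q\<close> is nonzero only at \<open>z\<close>, where it is finite, then
  almost surely \<open>roots \<phi> = {z}\<close>, so all the terms would be 0, whereas the mean hitting time of \<open>z\<close>
  is positive from every other state.
\<close>

definition zero_rate_term ::
    "('a::finite \<Rightarrow> 'a \<Rightarrow> real) \<Rightarrow> ('a \<Rightarrow> ennreal) \<Rightarrow> 'a \<Rightarrow> 'a \<Rightarrow> real" where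
  "zero_rate_term w Q x y =
     Lim (at_right 0) (\<lambda>\<epsilon>. 1 / \<epsilon> *
       (\<P>(\<phi> in forest_law w (Q(y := ennreal \<epsilon>)). roots \<phi> \<inter> tree_of \<phi> x = {y}) -
        \<P>(\<phi> in forest_law w (Q(y := ennreal \<epsilon>)). roots \<phi> = {y})))"

end

theory Submission
  imports Defs
begin

text \<open>
  A rooted forest is encoded as a map sending every vertex to its successor and fixing the roots, such
  that every orbit ends in a root. The mean hitting time of \<open>R\<close> from \<open>x\<close> is the sum over \<open>y \<notin> R\<close> of the
  weight of the forests with roots \<open>R \<union> {y}\<close> in which \<open>x\<close> belongs to the tree of \<open>y\<close>, divided by the
  weight \<open>Z R\<close> of the forests with roots \<open>R\<close>, because this function solves the Poisson equation.
  Averaging over the random root set cancels the denominator \<open>Z R\<close>, and \<open>(R, y) \<mapsto> R \<union> {y}\<close> turns the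
  sum into one over forests with at least two roots, with the factor \<open>q y\<close> missing. The characteristic
  polynomial is the generating function of forests by the number of roots: expanding \<open>det (q - L)\<close>
  linearly in the rows gives a sum over all maps, and the determinant attached to a map is 1 for a
  forest and 0 otherwise.
\<close>

section \<open>Forests as functions\<close>

inductive leads :: "('a \<Rightarrow> 'a) \<Rightarrow> 'a \<Rightarrow> 'a \<Rightarrow> bool" for f where
  leads_fixed: "f r = r \<Longrightarrow> leads f r r"
| leads_step: "leads f (f x) r \<Longrightarrow> leads f x r"

definition forest_fun :: "('a \<Rightarrow> 'a) \<Rightarrow> bool" where
  "forest_fun f \<longleftrightarrow> (\<forall>x. \<exists>r. leads f x r)"

definition root_of :: "('a \<Rightarrow> 'a) \<Rightarrow> 'a \<Rightarrow> 'a" where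
  "root_of f x = (THE r. leads f x r)"

definition fixed_points :: "('a \<Rightarrow> 'a) \<Rightarrow> 'a set" where
  "fixed_points f = {x. f x = x}"

lemma leads_imp_fixed: "leads f x r \<Longrightarrow> f r = r"
  by (induction rule: leads.induct) auto

lemma leads_fixed_unique: "leads f x r \<Longrightarrow> f x = x \<Longrightarrow> r = x"
  by (induction rule: leads.induct) auto

lemma leads_unique: "leads f x r \<Longrightarrow> leads f x s \<Longrightarrow> r = s"
proof (induction arbitrary: s rule: leads.induct)
  case (leads_fixed r)
  then show ?case
    using leads_fixed_unique by metis
next
  case (leads_step x r)
  from leads_step.prems show ?case
  proof (cases rule: leads.cases)
    case leads_fixed
    then show ?thesis
      using leads_step.hyps leads_fixed_unique by metis
  next
    case leads_step
    then show ?thesis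
      using leads_step.IH by blast
  qed
qed

lemma leads_apply: "leads f x r \<Longrightarrow> leads f (f x) r"
  by (erule leads.cases) (auto intro: leads.intros)

lemma root_of_eq: "leads f x r \<Longrightarrow> root_of f x = r"
  unfolding root_of_def using leads_unique by (metis theI)

lemma leads_root_of: "forest_fun f \<Longrightarrow> leads f x (root_of f x)"
  using root_of_eq forest_fun_def by metis

lemma root_of_eq_iff: "forest_fun f \<Longrightarrow> root_of f x = r \<longleftrightarrow> leads f x r"
  using leads_root_of root_of_eq by metis

lemma root_of_fixed: "f x = x \<Longrightarrow> root_of f x = x"
  by (simp add: leads_fixed root_of_eq)

lemma root_of_in_fixed_points: "forest_fun f \<Longrightarrow> root_of f x \<in> fixed_points f"
  by (simp add: fixed_points_def leads_imp_fixed[OF leads_root_of])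

lemma root_of_apply: "forest_fun f \<Longrightarrow> root_of f (f x) = root_of f x"
  by (rule root_of_eq) (rule leads_apply[OF leads_root_of])

lemma fixed_points_nonempty: "forest_fun f \<Longrightarrow> fixed_points f \<noteq> {}"
  using root_of_in_fixed_points[of f undefined] by auto

lemma leads_upd_keep:
  assumes "leads g v r" "g x = x" "r \<noteq> x"
  shows "leads (g(x := z)) v r"
  using assms
proof (induction rule: leads.induct)
  case (leads_fixed r)
  then show ?case
    by (intro leads.leads_fixed) simp
next
  case (leads_step v r)
  then have "v \<noteq> x"
    using leads_fixed_unique by metis
  with leads_step show ?case
    by - (rule leads.leads_step, simp)
qed

lemma leads_upd_redirect:
  assumes "leads g v x" "leads (g(x := z)) z r"
  shows "leads (g(x := z)) v r"
proof -
  have x: "leads (g(x := z)) x r"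
    by (rule leads.leads_step) (simp only: fun_upd_same assms(2))
  have "leads g v y \<Longrightarrow> y = x \<Longrightarrow> leads (g(x := z)) v r" for y
  proof (induction rule: leads.induct)
    case (leads_fixed y)
    with x show ?case
      by blast
  next
    case (leads_step v y)
    show ?case
    proof (cases "v = x")
      case True
      with x show ?thesis
        by blast
    next
      case False
      show ?thesis
        by (rule leads.leads_step) (simp only: fun_upd_other[OF False] leads_step)
    qed
  qed
  with assms show ?thesis
    by blast
qed

lemma leads_upd_cycle:
  assumes "leads g z x" "z \<noteq> x" "g x = x" "leads (g(x := z)) v r"
  shows "\<not> leads g v x"
  using assms(4)
proof (induction rule: leads.induct)
  case (leads_fixed r)
  then have "r \<noteq> x"
    using assms by auto
  then show ?case
    using leads_fixed leads_fixed_unique by (metis fun_upd_apply)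
next
  case (leads_step v r)
  then show ?case
    using assms leads_apply by (cases "v = x") (fastforce+)
qed

lemma forest_fun_upd:
  assumes "forest_fun g" "g x = x" "root_of g z \<noteq> x"
  shows "forest_fun (g(x := z))"
    and "root_of (g(x := z)) v = (if root_of g v = x then root_of g z else root_of g v)"
    and "fixed_points (g(x := z)) = fixed_points g - {x}"
proof -
  have z: "leads (g(x := z)) z (root_of g z)"
    by (rule leads_upd_keep) (simp_all add: assms leads_root_of)
  have *: "leads (g(x := z)) v (if root_of g v = x then root_of g z else root_of g v)" for v
  proof (cases "root_of g v = x")
    case True
    then have "leads g v x"
      using assms(1) leads_root_of by metis
    then show ?thesis
      using leads_upd_redirect[OF _ z] True by simp
  next
    case False
    then show ?thesis
      using leads_upd_keep[OF leads_root_of[OF assms(1)] assms(2)] by simp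
  qed
  then show "forest_fun (g(x := z))"
    unfolding forest_fun_def by blast
  show "root_of (g(x := z)) v = (if root_of g v = x then root_of g z else root_of g v)"
    by (rule root_of_eq[OF *])
  have "z \<noteq> x"
    using assms root_of_fixed by metis
  then show "fixed_points (g(x := z)) = fixed_points g - {x}"
    by (auto simp: fixed_points_def)
qed

lemma leads_cut: "leads f v r \<Longrightarrow> \<exists>s. leads (f(x := x)) v s"
proof (induction rule: leads.induct)
  case (leads_fixed r)
  then have "leads (f(x := x)) r r"
    by (intro leads.leads_fixed) simp
  then show ?case by blast
next
  case (leads_step v r)
  show ?case
  proof (cases "v = x")
    case True
    then have "leads (f(x := x)) v v"
      by (intro leads.leads_fixed) simp
    then show ?thesis by blast
  next
    case False
    with leads_step show ?thesis
      by (metis fun_upd_other leads.leads_step)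
  qed
qed

lemma forest_fun_cut:
  assumes "forest_fun f" "f x \<noteq> x"
  shows "forest_fun (f(x := x))" and "fixed_points (f(x := x)) = insert x (fixed_points f)"
    and "root_of (f(x := x)) (f x) \<noteq> x"
proof -
  show ff: "forest_fun (f(x := x))"
    using assms leads_cut unfolding forest_fun_def by metis
  show "fixed_points (f(x := x)) = insert x (fixed_points f)"
    by (auto simp: fixed_points_def)
  show "root_of (f(x := x)) (f x) \<noteq> x"
  proof
    assume "root_of (f(x := x)) (f x) = x"
    then have "leads (f(x := x)) (f x) x"
      using ff root_of_eq_iff by metis
    moreover have "leads ((f(x := x))(x := f x)) (f x) (root_of f (f x))"
      using assms leads_root_of by simp
    ultimately show False
      using assms leads_upd_cycle[of "f(x := x)" "f x" x "f x"] by simp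
  qed
qed

definition forests_rooted :: "'a set \<Rightarrow> ('a \<Rightarrow> 'a) set" where
  "forests_rooted R = {f. forest_fun f \<and> fixed_points f = R}"

lemma bij_betw_forests_rooted:
  assumes "x \<notin> R"
  shows "bij_betw (\<lambda>(g, z). g(x := z))
           (SIGMA g:forests_rooted (insert x R). {z. root_of g z \<noteq> x}) (forests_rooted R)"
proof (rule bij_betw_byWitness[where f' = "\<lambda>f. (f(x := x), f x)"])
  have fx: "g x = x" if "g \<in> forests_rooted (insert x R)" for g
    using that by (auto simp: forests_rooted_def fixed_points_def)
  then show "\<forall>p\<in>SIGMA g:forests_rooted (insert x R). {z. root_of g z \<noteq> x}.
      (\<lambda>f. (f(x := x), f x)) ((\<lambda>(g, z). g(x := z)) p) = p"
    by (auto simp: fun_upd_idem)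
  show "\<forall>f\<in>forests_rooted R. (\<lambda>(g, z). g(x := z)) (f(x := x), f x) = f"
    by simp
  show "(\<lambda>(g, z). g(x := z)) ` (SIGMA g:forests_rooted (insert x R). {z. root_of g z \<noteq> x})
      \<subseteq> forests_rooted R"
    using fx assms by (auto simp: forests_rooted_def forest_fun_upd)
  show "(\<lambda>f. (f(x := x), f x)) ` forests_rooted R
      \<subseteq> (SIGMA g:forests_rooted (insert x R). {z. root_of g z \<noteq> x})"
  proof -
    have "f x \<noteq> x" if "fixed_points f = R" for f
      using that assms by (auto simp: fixed_points_def)
    then show ?thesis
      by (auto simp: forests_rooted_def forest_fun_cut)
  qed
qed

section \<open>Weighted sums over forests with given roots\<close>

definition fun_weight :: "('a::finite \<Rightarrow> 'a \<Rightarrow> real) \<Rightarrow> ('a \<Rightarrow> 'a) \<Rightarrow> real" where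
  "fun_weight w f = (\<Prod>x\<in>- fixed_points f. w x (f x))"

lemma fun_weight_nonneg: "(\<And>x y. 0 \<le> w x y) \<Longrightarrow> 0 \<le> fun_weight w f"
  unfolding fun_weight_def by (intro prod_nonneg) auto

lemma fun_weight_upd:
  assumes "g x = x" "z \<noteq> x"
  shows "fun_weight w (g(x := z)) = fun_weight w g * w x z"
proof -
  have "- fixed_points (g(x := z)) = insert x (- fixed_points g)" "x \<notin> - fixed_points g"
    using assms by (auto simp: fixed_points_def)
  then have "fun_weight w (g(x := z)) = w x z * (\<Prod>v\<in>- fixed_points g. w v ((g(x := z)) v))"
    unfolding fun_weight_def by simp
  also have "(\<Prod>v\<in>- fixed_points g. w v ((g(x := z)) v)) = fun_weight w g"
    unfolding fun_weight_def using assms by (intro prod.cong) (auto simp: fixed_points_def)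
  finally show ?thesis
    by (simp only: mult.commute)
qed

definition rooted_weight :: "('a::finite \<Rightarrow> 'a \<Rightarrow> real) \<Rightarrow> 'a set \<Rightarrow> real" where
  "rooted_weight w R = (\<Sum>f\<in>forests_rooted R. fun_weight w f)"

definition routed_weight :: "('a::finite \<Rightarrow> 'a \<Rightarrow> real) \<Rightarrow> 'a \<Rightarrow> 'a \<Rightarrow> 'a set \<Rightarrow> real" where
  "routed_weight w x y R = (\<Sum>f\<in>forests_rooted R. fun_weight w f * of_bool (root_of f x = y))"

lemma sum_forests_rooted_upd:
  fixes w :: "'a::finite \<Rightarrow> 'a \<Rightarrow> real"
  assumes "x \<notin> R"
  shows "(\<Sum>f\<in>forests_rooted R. fun_weight w f * F f) =
    (\<Sum>g\<in>forests_rooted (insert x R). fun_weight w g *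
       (\<Sum>z\<in>UNIV. of_bool (root_of g z \<noteq> x) * w x z * F (g(x := z))))"
proof -
  have "(\<Sum>f\<in>forests_rooted R. fun_weight w f * F f) =
      (\<Sum>(g, z)\<in>(SIGMA g:forests_rooted (insert x R). {z. root_of g z \<noteq> x}).
         fun_weight w (g(x := z)) * F (g(x := z)))"
    using sum.reindex_bij_betw[OF bij_betw_forests_rooted[OF assms],
        where g = "\<lambda>f. fun_weight w f * F f"]
    by (simp add: case_prod_unfold)
  also have "\<dots> = (\<Sum>g\<in>forests_rooted (insert x R). \<Sum>z\<in>{z. root_of g z \<noteq> x}.
         fun_weight w (g(x := z)) * F (g(x := z)))"
    by (subst sum.Sigma) auto
  also have "\<dots> = (\<Sum>g\<in>forests_rooted (insert x R). fun_weight w g *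
       (\<Sum>z\<in>UNIV. of_bool (root_of g z \<noteq> x) * w x z * F (g(x := z))))"
  proof (rule sum.cong[OF refl])
    fix g assume g: "g \<in> forests_rooted (insert x R)"
    then have gx: "g x = x"
      by (auto simp: forests_rooted_def fixed_points_def)
    have "(\<Sum>z\<in>{z. root_of g z \<noteq> x}. fun_weight w (g(x := z)) * F (g(x := z))) =
        (\<Sum>z\<in>{z. root_of g z \<noteq> x}. fun_weight w g * (w x z * F (g(x := z))))"
    proof (rule sum.cong[OF refl])
      fix z assume "z \<in> {z. root_of g z \<noteq> x}"
      then have "z \<noteq> x"
        using root_of_fixed[of g x, OF gx] by auto
      then show "fun_weight w (g(x := z)) * F (g(x := z)) = fun_weight w g * (w x z * F (g(x := z)))"
        by (simp only: fun_weight_upd[of g x z w, OF gx] mult.assoc not_False_eq_True)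
    qed
    also have "\<dots> = (\<Sum>z\<in>UNIV. fun_weight w g * (of_bool (root_of g z \<noteq> x) * w x z * F (g(x := z))))"
      by (intro sum.mono_neutral_cong_left) auto
    finally show "(\<Sum>z\<in>{z. root_of g z \<noteq> x}. fun_weight w (g(x := z)) * F (g(x := z))) =
        fun_weight w g * (\<Sum>z\<in>UNIV. of_bool (root_of g z \<noteq> x) * w x z * F (g(x := z)))"
      by (simp add: sum_distrib_left)
  qed
  finally show ?thesis .
qed

text \<open>
  With \<open>x\<close> cut off as an additional root, the forests with \<open>x\<close> not a root are obtained by choosing
  a vertex \<open>z\<close> outside the tree of \<open>x\<close> and adding the edge \<open>(x, z)\<close>. For a fixed forest \<open>g\<close> rooted
  at \<open>x\<close> as well, both sides become the same quadratic expression in the rates \<open>w x z\<close>.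
\<close>

lemma routed_weight_harmonic:
  fixes w :: "'a::finite \<Rightarrow> 'a \<Rightarrow> real"
  assumes "x \<notin> R" "y \<in> R"
  shows "(\<Sum>z\<in>UNIV. w x z * routed_weight w z y R) = (\<Sum>z\<in>UNIV. w x z) * routed_weight w x y R"
proof -
  define G where "G = forests_rooted (insert x R)"
  define c where "c g v = (\<Sum>z\<in>UNIV. w x z * of_bool (root_of g z = v))" for g v
  have xy: "x \<noteq> y"
    using assms by auto
  have fx: "forest_fun g" "g x = x" if "g \<in> G" for g
    using that by (auto simp: G_def forests_rooted_def fixed_points_def)
  have nx: "(\<Sum>z\<in>UNIV. of_bool (root_of g z \<noteq> x) * w x z) = (\<Sum>z\<in>UNIV. w x z) - c g x" for g
    unfolding c_def sum_subtractf[symmetric] by (intro sum.cong) auto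
  have routed: "routed_weight w v y R = (\<Sum>g\<in>G. fun_weight w g *
      (of_bool (root_of g v = y) * ((\<Sum>z\<in>UNIV. w x z) - c g x) + of_bool (root_of g v = x) * c g y))"
    for v
  proof -
    have "routed_weight w v y R = (\<Sum>g\<in>G. fun_weight w g * (\<Sum>z\<in>UNIV.
        of_bool (root_of g z \<noteq> x) * w x z * of_bool (root_of (g(x := z)) v = y)))"
      unfolding routed_weight_def G_def by (rule sum_forests_rooted_upd[OF assms(1)])
    also have "\<dots> = (\<Sum>g\<in>G. fun_weight w g * (\<Sum>z\<in>UNIV.
        of_bool (root_of g v = y) * (of_bool (root_of g z \<noteq> x) * w x z) +
        of_bool (root_of g v = x) * (w x z * of_bool (root_of g z = y))))"
      using fx xy
      by (intro sum.cong arg_cong2[where f = "(*)"] refl) (auto simp: forest_fun_upd)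
    also have "\<dots> = (\<Sum>g\<in>G. fun_weight w g *
      (of_bool (root_of g v = y) * ((\<Sum>z\<in>UNIV. w x z) - c g x) + of_bool (root_of g v = x) * c g y))"
      by (simp add: sum.distrib sum_distrib_left[symmetric] nx) (simp add: c_def)
    finally show ?thesis .
  qed
  have "(\<Sum>z\<in>UNIV. w x z * routed_weight w z y R) = (\<Sum>g\<in>G. fun_weight w g *
      (\<Sum>z\<in>UNIV. w x z * of_bool (root_of g z = y) * ((\<Sum>z\<in>UNIV. w x z) - c g x) +
                 w x z * of_bool (root_of g z = x) * c g y))"
    unfolding routed sum_distrib_left by (subst sum.swap) (simp add: algebra_simps)
  also have "\<dots> = (\<Sum>g\<in>G. fun_weight w g * ((\<Sum>z\<in>UNIV. w x z) * c g y))"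
    by (intro sum.cong arg_cong2[where f = "(*)"] refl,
        simp only: sum.distrib sum_distrib_right[symmetric] c_def[symmetric])
      (simp add: algebra_simps)
  also have "\<dots> = (\<Sum>g\<in>G. (\<Sum>z\<in>UNIV. w x z) * (fun_weight w g *
      (of_bool (root_of g x = y) * ((\<Sum>z\<in>UNIV. w x z) - c g x) + of_bool (root_of g x = x) * c g y)))"
    using fx xy by (intro sum.cong refl) (simp add: root_of_fixed)
  also have "\<dots> = (\<Sum>z\<in>UNIV. w x z) * routed_weight w x y R"
    unfolding routed by (rule sum_distrib_left[symmetric])
  finally show ?thesis .
qed

lemma routed_weight_at_root:
  assumes "y \<in> R"
  shows "routed_weight w y y R = rooted_weight w R"
  unfolding routed_weight_def rooted_weight_def
  using assms by (intro sum.cong) (auto simp: forests_rooted_def fixed_points_def root_of_fixed)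

lemma routed_weight_root_neq:
  assumes "x \<in> R" "x \<noteq> y"
  shows "routed_weight w x y R = 0"
  unfolding routed_weight_def
  using assms by (intro sum.neutral) (auto simp: forests_rooted_def fixed_points_def root_of_fixed)

lemma routed_weight_jump:
  fixes w :: "'a::finite \<Rightarrow> 'a \<Rightarrow> real"
  assumes "y \<notin> R"
  shows "(\<Sum>z\<in>UNIV. w y z * routed_weight w z y (insert y R)) =
    (\<Sum>z\<in>UNIV. w y z) * routed_weight w y y (insert y R) - rooted_weight w R"
proof -
  define G where "G = forests_rooted (insert y R)"
  have "rooted_weight w R = (\<Sum>g\<in>G. fun_weight w g *
       (\<Sum>z\<in>UNIV. of_bool (root_of g z \<noteq> y) * w y z))"
    unfolding rooted_weight_def G_def
    using sum_forests_rooted_upd[OF assms, where F = "\<lambda>_. 1" and w = w] by simp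
  also have "\<dots> = (\<Sum>g\<in>G. \<Sum>z\<in>UNIV. w y z * fun_weight w g -
       w y z * (fun_weight w g * of_bool (root_of g z = y)))"
    unfolding sum_distrib_left by (intro sum.cong) (auto simp: of_bool_def)
  also have "\<dots> = (\<Sum>z\<in>UNIV. w y z * rooted_weight w (insert y R)) -
      (\<Sum>z\<in>UNIV. w y z * routed_weight w z y (insert y R))"
    unfolding rooted_weight_def routed_weight_def G_def[symmetric] sum_distrib_left
    by (subst sum.swap) (simp add: sum_subtractf)
  finally show ?thesis
    by (simp add: routed_weight_at_root sum_distrib_right)
qed

definition forest_hitting :: "('a::finite \<Rightarrow> 'a \<Rightarrow> real) \<Rightarrow> 'a set \<Rightarrow> 'a \<Rightarrow> real" where
  "forest_hitting w R x = (\<Sum>y\<in>- R. routed_weight w x y (insert y R)) / rooted_weight w R"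

lemma forest_hitting_nonneg: "(\<And>x y. 0 \<le> w x y) \<Longrightarrow> 0 \<le> forest_hitting w R x"
  unfolding forest_hitting_def routed_weight_def rooted_weight_def
  by (intro divide_nonneg_nonneg sum_nonneg mult_nonneg_nonneg) (auto intro: fun_weight_nonneg)

lemma forest_hitting_root: "x \<in> R \<Longrightarrow> forest_hitting w R x = 0"
  unfolding forest_hitting_def by (auto intro!: sum.neutral routed_weight_root_neq)

lemma forest_hitting_poisson:
  fixes w :: "'a::finite \<Rightarrow> 'a \<Rightarrow> real"
  assumes "x \<notin> R" "rooted_weight w R \<noteq> 0"
  shows "(\<Sum>z\<in>UNIV. w x z * (forest_hitting w R z - forest_hitting w R x)) = - 1"
proof -
  have *: "(\<Sum>z\<in>UNIV. w x z * (routed_weight w z y (insert y R) - routed_weight w x y (insert y R))) =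
      (if y = x then - rooted_weight w R else 0)" if "y \<in> - R" for y
    using that assms(1) routed_weight_harmonic[of x "insert y R" y w] routed_weight_jump[of x R w]
    by (auto simp: right_diff_distrib sum_subtractf sum_distrib_right)
  have "(\<Sum>z\<in>UNIV. w x z * (forest_hitting w R z - forest_hitting w R x)) =
     (\<Sum>z\<in>UNIV. \<Sum>y\<in>- R. w x z *
        (routed_weight w z y (insert y R) - routed_weight w x y (insert y R))) / rooted_weight w R"
    unfolding forest_hitting_def
    by (simp add: sum_divide_distrib sum_subtractf[symmetric] diff_divide_distrib[symmetric]
        sum_distrib_left)
  also have "\<dots> = (\<Sum>y\<in>- R. if y = x then - rooted_weight w R else 0) / rooted_weight w R"
    by (subst sum.swap) (simp add: *)
  also have "\<dots> = - 1"
    using assms by simp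
  finally show ?thesis .
qed

section \<open>Existence of forests with given roots\<close>

lemma rooted_weight_pos:
  fixes w :: "'a::finite \<Rightarrow> 'a \<Rightarrow> real"
  assumes rates: "\<And>x y. 0 \<le> w x y" and irred: "irreducible_rates w" and "R \<noteq> {}"
  shows "0 < rooted_weight w R"
proof -
  define d where "d x = (LEAST k. \<exists>r\<in>R. (x, r) \<in> edges w ^^ k)" for x
  have ex: "\<exists>k. \<exists>r\<in>R. (x, r) \<in> edges w ^^ k" for x
    using irred \<open>R \<noteq> {}\<close> rtrancl_imp_relpow unfolding irreducible_rates_def by blast
  have dx: "\<exists>r\<in>R. (x, r) \<in> edges w ^^ d x" for x
    unfolding d_def by (rule LeastI_ex[OF ex])
  have "\<exists>z. (x, z) \<in> edges w \<and> d z < d x" if x: "x \<notin> R" for x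
  proof -
    obtain r where r: "r \<in> R" "(x, r) \<in> edges w ^^ d x"
      using dx by blast
    with x obtain k where k: "d x = Suc k"
      by (cases "d x") auto
    with r obtain z where z: "(x, z) \<in> edges w" "(z, r) \<in> edges w ^^ k"
      by (metis relpow_Suc_D2)
    then have "d z \<le> k"
      unfolding d_def using r(1) by (intro Least_le) blast
    with z k show ?thesis
      by auto
  qed
  then obtain s where s: "\<And>x. x \<notin> R \<Longrightarrow> (x, s x) \<in> edges w \<and> d (s x) < d x"
    by metis
  define f where "f x = (if x \<in> R then x else s x)" for x
  have "\<exists>r. leads f x r" for x
  proof (induction x rule: measure_induct_rule[of d])
    case (less x)
    show ?case
    proof (cases "x \<in> R")
      case True
      then show ?thesis
        by (auto intro!: exI leads_fixed simp: f_def)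
    next
      case False
      then have "f x = s x" "d (s x) < d x"
        using s by (simp_all add: f_def)
      then obtain r where "leads f (f x) r"
        using less by metis
      then show ?thesis
        by (intro exI) (rule leads_step)
    qed
  qed
  moreover have roots: "fixed_points f = R"
  proof -
    have "s x \<noteq> x" if "x \<notin> R" for x
      using s[OF that] by auto
    then show ?thesis
      by (auto simp: fixed_points_def f_def)
  qed
  ultimately have "f \<in> forests_rooted R"
    by (simp add: forests_rooted_def forest_fun_def)
  moreover have "0 < fun_weight w f"
    unfolding fun_weight_def roots using s by (intro prod_pos) (auto simp: f_def edges_def)
  ultimately show ?thesis
    unfolding rooted_weight_def using rates by (intro sum_pos2[where i = f]) (auto intro: fun_weight_nonneg)
qed

section \<open>Functional description of spanning rooted forests\<close>

definition edge_set :: "('a \<Rightarrow> 'a) \<Rightarrow> ('a \<times> 'a) set" where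
  "edge_set f = {(x, y). y = f x \<and> y \<noteq> x}"

lemma roots_edge_set: "roots (edge_set f) = fixed_points f"
  by (auto simp: roots_def edge_set_def fixed_points_def)

lemma inj_edge_set: "inj edge_set"
proof (rule injI, rule ext)
  fix f g :: "'a \<Rightarrow> 'a" and x
  assume "edge_set f = edge_set g"
  then have "(x, f x) \<in> edge_set f \<longleftrightarrow> (x, f x) \<in> edge_set g"
    and "(x, g x) \<in> edge_set f \<longleftrightarrow> (x, g x) \<in> edge_set g"
    by simp_all
  then show "f x = g x"
    by (auto simp: edge_set_def)
qed

definition undirected :: "('a \<Rightarrow> 'a) \<Rightarrow> ('a \<times> 'a) set" where
  "undirected f = edge_set f \<union> (edge_set f)\<inverse>"

lemma root_of_connected:
  assumes "forest_fun f" "(u, v) \<in> (undirected f)\<^sup>*"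
  shows "root_of f v = root_of f u"
  using assms(2)
proof (induction rule: rtrancl_induct)
  case (step y z)
  then have "z = f y \<or> y = f z"
    by (auto simp: undirected_def edge_set_def)
  with step.IH show ?case
    using root_of_apply[OF assms(1)] by metis
qed simp

lemma leads_connected: "leads f x r \<Longrightarrow> (x, r) \<in> (undirected f)\<^sup>*"
proof (induction rule: leads.induct)
  case (leads_step x r)
  show ?case
  proof (cases "f x = x")
    case True
    then show ?thesis
      using leads_step by simp
  next
    case False
    then have "(x, f x) \<in> undirected f"
      by (simp add: undirected_def edge_set_def)
    then show ?thesis
      using leads_step.IH by (rule converse_rtrancl_into_rtrancl)
  qed
qed simp

lemma root_of_connected_fixed:
  assumes "forest_fun f" "r \<in> fixed_points f" "(x, r) \<in> (undirected f)\<^sup>*"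
  shows "r = root_of f x"
proof -
  have "root_of f r = r"
    using assms(2) by (simp add: fixed_points_def root_of_fixed)
  then show ?thesis
    using root_of_connected[OF assms(1,3)] by simp
qed

lemma roots_Int_tree_of:
  assumes "forest_fun f"
  shows "roots (edge_set f) \<inter> tree_of (edge_set f) x = {root_of f x}"
proof -
  have "tree_of (edge_set f) x = {y. (x, y) \<in> (undirected f)\<^sup>*}"
    by (simp add: tree_of_def undirected_def)
  moreover have "(x, root_of f x) \<in> (undirected f)\<^sup>*"
    by (rule leads_connected[OF leads_root_of[OF assms]])
  moreover have "r = root_of f x" if "r \<in> fixed_points f" "(x, r) \<in> (undirected f)\<^sup>*" for r
    by (rule root_of_connected_fixed[OF assms that])
  moreover have "root_of f x \<in> fixed_points f"
    by (rule root_of_in_fixed_points[OF assms])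
  ultimately show ?thesis
    unfolding roots_edge_set by blast
qed

lemma root_choice_undirected:
  assumes "forest_fun f"
  shows "root_choice (undirected f) (fixed_points f)"
  unfolding root_choice_def
proof
  fix x
  show "\<exists>!r. r \<in> fixed_points f \<and> (x, r) \<in> (undirected f)\<^sup>*"
  proof (rule ex1I[of _ "root_of f x"])
    show "root_of f x \<in> fixed_points f \<and> (x, root_of f x) \<in> (undirected f)\<^sup>*"
      using root_of_in_fixed_points[OF assms] leads_connected[OF leads_root_of[OF assms]] by blast
  qed (use root_of_connected_fixed[OF assms] in blast)
qed

definition depth :: "('a \<Rightarrow> 'a) \<Rightarrow> 'a \<Rightarrow> nat" where
  "depth f x = (LEAST k. f ((f ^^ k) x) = (f ^^ k) x)"

lemma leads_funpow: "leads f x r \<Longrightarrow> \<exists>k. (f ^^ k) x = r"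
proof (induction rule: leads.induct)
  case (leads_fixed r)
  then show ?case
    by (intro exI[of _ 0]) simp
next
  case (leads_step x r)
  then obtain k where "(f ^^ k) (f x) = r"
    by blast
  then show ?case
    by (intro exI[of _ "Suc k"]) (simp add: funpow_swap1)
qed

lemma depth_apply:
  assumes "forest_fun f" "f x \<noteq> x"
  shows "depth f x = Suc (depth f (f x))"
proof -
  obtain k where k: "(f ^^ k) x = root_of f x"
    using leads_funpow[OF leads_root_of[OF assms(1)]] by blast
  have "f (root_of f x) = root_of f x"
    by (rule leads_imp_fixed[OF leads_root_of[OF assms(1)]])
  with k have "f ((f ^^ k) x) = (f ^^ k) x"
    by simp
  then have "(LEAST k. f ((f ^^ k) x) = (f ^^ k) x) =
      Suc (LEAST k. f ((f ^^ Suc k) x) = (f ^^ Suc k) x)"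
    using assms(2) by (intro Least_Suc) auto
  then show ?thesis
    unfolding depth_def by (simp add: funpow_swap1)
qed

lemma depth_undirected:
  assumes "forest_fun f" "(v, u) \<in> undirected f" "depth f u \<le> depth f v"
  shows "u = f v"
proof (rule ccontr)
  assume "u \<noteq> f v"
  with assms(2) have "v = f u" "f u \<noteq> u"
    by (auto simp: undirected_def edge_set_def)
  then show False
    using depth_apply[OF assms(1), of u] assms(3) by simp
qed

lemma undirected_acyclic_undirected:
  assumes "forest_fun f"
  shows "undirected_acyclic (undirected f)"
  unfolding undirected_acyclic_def
proof (intro conjI notI)
  show sym: "sym (undirected f)"
    by (auto simp: undirected_def sym_def)
  show "irrefl (undirected f)"
    by (auto simp: undirected_def edge_set_def irrefl_def)
  assume "\<exists>c. 3 \<le> length c \<and> simple_path (undirected f) c \<and> (last c, hd c) \<in> undirected f"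
  then obtain c where c: "3 \<le> length c" "simple_path (undirected f) c"
      "(last c, hd c) \<in> undirected f"
    by blast
  define n where "n = length c"
  have n: "3 \<le> n" "c \<noteq> []"
    using c by (auto simp: n_def)
  have dist: "distinct c"
    using c by (simp add: simple_path_def)
  have edge: "(c ! i, c ! ((i + 1) mod n)) \<in> undirected f" if "i < n" for i
  proof (cases "i + 1 = n")
    case True
    then have "i = length c - 1"
      by (simp add: n_def)
    with True c(3) n show ?thesis
      by (simp add: last_conv_nth hd_conv_nth)
  next
    case False
    with that have "i + 1 < n"
      by simp
    then show ?thesis
      using c(2) by (simp add: simple_path_def successively_conv_nth n_def)
  qed
  obtain i where i: "i < n" "\<And>j. j < n \<Longrightarrow> depth f (c ! j) \<le> depth f (c ! i)"
  proof -
    obtain v where v: "v \<in> set c" "\<And>u. u \<in> set c \<Longrightarrow> depth f u \<le> depth f v"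
    proof -
      have "Max (depth f ` set c) \<in> depth f ` set c"
        using n by (intro Max_in) auto
      then obtain v where v: "v \<in> set c" "depth f v = Max (depth f ` set c)"
        by auto
      have "depth f u \<le> depth f v" if "u \<in> set c" for u
        unfolding v(2) using that by (intro Max_ge) auto
      with v(1) that show ?thesis
        by blast
    qed
    then show ?thesis
      using that by (metis in_set_conv_nth n_def nth_mem)
  qed
  define j where "j = (i + 1) mod n"
  define k where "k = (if i = 0 then n - 1 else i - 1)"
  have jk: "j < n" "k < n" "(k + 1) mod n = i" "j \<noteq> k"
    using i n by (auto simp: j_def k_def mod_Suc)
  have "c ! j = f (c ! i)"
    using edge[OF i(1)] i(2)[OF jk(1)] depth_undirected[OF assms] unfolding j_def by blast
  moreover have "c ! k = f (c ! i)"
  proof -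
    have "(c ! i, c ! k) \<in> undirected f"
      using edge[OF jk(2)] symD[OF sym] unfolding jk(3) by blast
    then show ?thesis
      using i(2)[OF jk(2)] depth_undirected[OF assms] by blast
  qed
  ultimately have "c ! j = c ! k"
    by simp
  then show False
    using jk dist by (simp add: nth_eq_iff_index_eq n_def)
qed

lemma path_to_root:
  assumes "forest_fun f" "leads f v r"
  shows "\<exists>p. simple_path (undirected f) (v # p) \<and> last (v # p) = r \<and> (\<forall>u\<in>set p. depth f u < depth f v)"
  using assms(2)
proof (induction rule: leads.induct)
  case (leads_fixed r)
  then show ?case
    by (intro exI[of _ "[]"]) (simp add: simple_path_def)
next
  case (leads_step v r)
  then obtain p where p: "simple_path (undirected f) (f v # p)" "last (f v # p) = r"
      "\<forall>u\<in>set p. depth f u < depth f (f v)"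
    by blast
  show ?case
  proof (cases "f v = v")
    case True
    with p show ?thesis
      by auto
  next
    case False
    then have lt: "\<forall>u\<in>set (f v # p). depth f u < depth f v"
      using p(3) depth_apply[OF assms(1), of v] by auto
    moreover have "(v, f v) \<in> undirected f"
      using False by (simp add: undirected_def edge_set_def)
    ultimately have "simple_path (undirected f) (v # f v # p)"
      using p(1) by (auto simp: simple_path_def)
    with lt p(2) show ?thesis
      by (intro exI[of _ "f v # p"]) simp
  qed
qed

lemma path_away_from_root:
  assumes "simple_path (undirected f) (u # v # p)" "f v = u"
  shows "last (v # p) \<notin> fixed_points f"
  using assms
proof (induction p arbitrary: u v)
  case Nil
  then show ?case
    by (auto simp: simple_path_def fixed_points_def)
next
  case (Cons x p)
  then have "(v, x) \<in> undirected f" "x \<noteq> f v"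
    by (auto simp: simple_path_def)
  then have "f x = v"
    by (auto simp: undirected_def edge_set_def)
  moreover have "simple_path (undirected f) (v # x # p)"
    using Cons.prems by (simp add: simple_path_def)
  ultimately show ?case
    using Cons.IH by simp
qed

lemma orient_undirected:
  assumes "forest_fun f"
  shows "orient (undirected f) (fixed_points f) = edge_set f"
proof (intro set_eqI iffI; clarify)
  fix u v assume "(u, v) \<in> orient (undirected f) (fixed_points f)"
  then obtain p where p: "simple_path (undirected f) (u # v # p)" "last (u # v # p) \<in> fixed_points f"
    by (auto simp: orient_def)
  then have "f v \<noteq> u"
    using path_away_from_root[OF p(1)] by auto
  moreover have "(u, v) \<in> undirected f"
    using p(1) by (simp add: simple_path_def)
  ultimately show "(u, v) \<in> edge_set f"
    by (auto simp: undirected_def edge_set_def)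
next
  fix u v assume "(u, v) \<in> edge_set f"
  then have v: "v = f u" "f u \<noteq> u"
    by (auto simp: edge_set_def)
  obtain p where p: "simple_path (undirected f) (v # p)" "last (v # p) = root_of f v"
      "\<forall>x\<in>set p. depth f x < depth f v"
    using path_to_root[OF assms leads_root_of[OF assms]] by blast
  have "depth f u = Suc (depth f v)"
    using depth_apply[OF assms] v by simp
  then have "u \<notin> set (v # p)"
    using p(3) v by auto
  moreover have "(u, v) \<in> undirected f"
    using v by (simp add: undirected_def edge_set_def)
  ultimately have "simple_path (undirected f) (u # v # p)"
    using p(1) by (auto simp: simple_path_def)
  moreover have "last (u # v # p) \<in> fixed_points f"
    using p(2) root_of_in_fixed_points[OF assms] by simp
  ultimately show "(u, v) \<in> orient (undirected f) (fixed_points f)"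
    unfolding orient_def by blast
qed

lemma simple_path_first_step_unique:
  assumes "undirected_acyclic G" "simple_path G (u # v # p)" "simple_path G (u # v' # p')"
    and "last (v # p) = last (v' # p')"
  shows "v = v'"
proof (rule ccontr)
  assume "v \<noteq> v'"
  have "\<exists>x\<in>set (v # p). x \<in> set (v' # p')"
    using assms(4) last_in_set by (metis list.distinct(1))
  then obtain a x b where ab: "v # p = a @ x # b" "x \<in> set (v' # p')"
      "\<forall>y\<in>set a. y \<notin> set (v' # p')"
    using split_list_first_prop[of "v # p" "\<lambda>x. x \<in> set (v' # p')"] by blast
  then obtain c d where cd: "v' # p' = c @ x # d"
    by (meson split_list)
  have P: "u \<notin> set (a @ x # b)" "distinct (a @ x # b)"
      "successively (\<lambda>u v. (u, v) \<in> G) (u # a @ x # b)"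
    using assms(2) unfolding ab(1) simple_path_def by auto
  have Q: "u \<notin> set (c @ x # d)" "distinct (c @ x # d)"
      "successively (\<lambda>u v. (u, v) \<in> G) (u # c @ x # d)"
    using assms(3) unfolding cd simple_path_def by auto
  have sym: "(y, z) \<in> G \<Longrightarrow> (z, y) \<in> G" for y z
    using assms(1) by (meson undirected_acyclic_def symE)
  have R: "successively (\<lambda>u v. (u, v) \<in> G) (x # rev c)"
  proof -
    have "successively (\<lambda>u v. (u, v) \<in> G) (c @ [x])"
      using Q(3) by (auto simp: successively_Cons successively_append_iff)
    then have "successively (\<lambda>u v. (v, u) \<in> G) (rev (c @ [x]))"
      by (simp only: successively_rev)
    then show ?thesis
      by (auto elim!: successively_mono intro: sym)
  qed
  define C where "C = u # a @ x # rev c"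
  have "simple_path G C"
  proof -
    have "set a \<inter> set c = {}"
      using ab(3) cd by auto
    then have "distinct C"
      using P(1,2) Q(1,2) by (auto simp: C_def)
    moreover have "successively (\<lambda>u v. (u, v) \<in> G) (u # a @ x # rev c)"
      using P(3) R by (auto simp: successively_Cons successively_append_iff hd_append)
    ultimately show ?thesis
      by (simp add: simple_path_def C_def)
  qed
  moreover have "(last C, hd C) \<in> G"
  proof -
    have "last C = hd (c @ x # d)"
      by (cases c) (auto simp: C_def)
    moreover have "(u, hd (c @ x # d)) \<in> G"
      using Q(3) by (simp add: successively_Cons)
    ultimately show ?thesis
      using sym by (simp add: C_def)
  qed
  moreover have "length C \<ge> 3"
  proof (rule ccontr)
    assume "\<not> length C \<ge> 3"
    then have "a = []" "c = []"
      by (auto simp: C_def Suc_le_eq)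
    then show False
      using ab(1) cd \<open>v \<noteq> v'\<close> by simp
  qed
  ultimately show False
    using assms(1) unfolding undirected_acyclic_def by blast
qed

lemma orient_functional:
  assumes "undirected_acyclic G" "root_choice G R" "(u, v) \<in> orient G R" "(u, v') \<in> orient G R"
  shows "v = v'"
proof -
  obtain p p' where p: "simple_path G (u # v # p)" "last (u # v # p) \<in> R"
      and p': "simple_path G (u # v' # p')" "last (u # v' # p') \<in> R"
    using assms(3,4) by (auto simp: orient_def)
  have "(u, last (u # v # p)) \<in> G\<^sup>*" "(u, last (u # v' # p')) \<in> G\<^sup>*"
    using simple_path_rtrancl[OF p(1)] simple_path_rtrancl[OF p'(1)] by simp_all
  then have "last (u # v # p) = last (u # v' # p')"
    using assms(2) p(2) p'(2) unfolding root_choice_def by blast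
  then show ?thesis
    using simple_path_first_step_unique[OF assms(1) p(1) p'(1)] by simp
qed

lemma orient_is_edge_set:
  assumes "undirected_acyclic G" "root_choice G R"
  shows "\<exists>f. forest_fun f \<and> orient G R = edge_set f"
proof -
  define f where "f u = (if \<exists>v. (u, v) \<in> orient G R then SOME v. (u, v) \<in> orient G R else u)" for u
  have f_eq: "f u = v" if "(u, v) \<in> orient G R" for u v
  proof -
    have "f u = (SOME v. (u, v) \<in> orient G R)"
      unfolding f_def using that by (intro if_P exI)
    moreover have "(u, SOME v. (u, v) \<in> orient G R) \<in> orient G R"
      by (rule someI[of "\<lambda>v. (u, v) \<in> orient G R", OF that])
    ultimately show ?thesis
      using orient_functional[OF assms _ that] by metis
  qed
  have irr: "u \<noteq> v" if "(u, v) \<in> orient G R" for u v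
    using that by (auto simp: orient_def simple_path_def)
  have edge: "orient G R = edge_set f"
  proof (intro set_eqI iffI; clarify)
    fix u v assume "(u, v) \<in> orient G R"
    then show "(u, v) \<in> edge_set f"
      using f_eq irr by (auto simp: edge_set_def)
  next
    fix u v assume uv: "(u, v) \<in> edge_set f"
    then have "f u = v" "f u \<noteq> u"
      by (auto simp: edge_set_def)
    then obtain v' where v': "(u, v') \<in> orient G R"
      unfolding f_def by metis
    with f_eq[OF v'] \<open>f u = v\<close> show "(u, v) \<in> orient G R"
      by simp
  qed
  have path: "leads f (hd p) (last p)" if "simple_path G p" "last p \<in> R" for p
    using that
  proof (induction p)
    case Nil
    then show ?case
      by (simp add: simple_path_def)
  next
    case (Cons u p)
    show ?case
    proof (cases p)
      case Nil
      with Cons.prems have "u \<in> roots (orient G R)"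
        using roots_orient[OF assms(2)] by simp
      then have "f u = u"
        by (auto simp: f_def roots_def)
      with Nil show ?thesis
        by (simp add: leads_fixed)
    next
      case (Cons v p')
      with Cons.prems have "(u, v) \<in> orient G R"
        unfolding orient_def by blast
      then have "f u = v"
        by (rule f_eq)
      moreover have "leads f v (last p)"
        using Cons.IH Cons.prems Cons by (simp add: simple_path_def)
      ultimately have "leads f u (last p)"
        by (intro leads_step[of f u]) simp
      with Cons show ?thesis
        by simp
    qed
  qed
  have "forest_fun f"
    unfolding forest_fun_def
  proof
    fix x
    obtain r where "r \<in> R" "(x, r) \<in> G\<^sup>*"
      using assms(2) unfolding root_choice_def by blast
    then obtain p where "simple_path G p" "hd p = x" "last p \<in> R"
      using rtrancl_simple_path by metis
    then show "\<exists>r. leads f x r"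
      using path by metis
  qed
  with edge show ?thesis
    by blast
qed

lemma edge_set_in_spanning_rooted_forests:
  assumes "forest_fun f"
  shows "edge_set f \<in> spanning_rooted_forests"
  unfolding spanning_rooted_forests_def orient_undirected[OF assms, symmetric]
  using undirected_acyclic_undirected[OF assms] root_choice_undirected[OF assms] by auto

lemma spanning_rooted_forests_eq: "spanning_rooted_forests = edge_set ` {f. forest_fun f}"
proof (intro subset_antisym subsetI)
  fix \<phi> :: "('a \<times> 'a) set" assume "\<phi> \<in> spanning_rooted_forests"
  then obtain G R where "\<phi> = orient G R" "undirected_acyclic G" "root_choice G R"
    unfolding spanning_rooted_forests_def by blast
  then show "\<phi> \<in> edge_set ` {f. forest_fun f}"
    using orient_is_edge_set[of G R] by auto
next
  fix \<phi> :: "('a \<times> 'a) set" assume "\<phi> \<in> edge_set ` {f. forest_fun f}"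
  then show "\<phi> \<in> spanning_rooted_forests"
    using edge_set_in_spanning_rooted_forests by auto
qed

section \<open>The matrix exponential near zero\<close>

definition mpower :: "real ^ 'n ^ 'n \<Rightarrow> nat \<Rightarrow> real ^ 'n ^ 'n" where
  "mpower A k = ((\<lambda>B. A ** B) ^^ k) (mat 1)"

lemma mpower_0: "mpower A 0 = mat 1"
  by (simp add: mpower_def)

lemma mpower_Suc_nth: "mpower A (Suc k) $ x $ y = (\<Sum>z\<in>UNIV. A $ x $ z * mpower A k $ z $ y)"
  by (simp add: mpower_def matrix_matrix_mult_def)

lemma mpower_scaleR: "mpower (t *\<^sub>R A) k = t ^ k *\<^sub>R mpower A k"
proof (induction k)
  case (Suc k)
  have "mpower (t *\<^sub>R A) (Suc k) $ x $ y = (t ^ Suc k *\<^sub>R mpower A (Suc k)) $ x $ y" for x y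
    by (simp add: mpower_Suc_nth Suc sum_distrib_left mult_ac)
  then show ?case
    by (simp add: vec_eq_iff)
qed (simp add: mpower_0)

lemma abs_mpower_nth_le:
  fixes A :: "real ^ 'n ^ 'n"
  shows "\<bar>mpower A k $ x $ y\<bar> \<le> (\<Sum>x\<in>UNIV. \<Sum>y\<in>UNIV. \<bar>A $ x $ y\<bar>) ^ k" (is "_ \<le> ?M ^ k")
proof (induction k arbitrary: x)
  case 0
  show ?case
    by (simp add: mpower_0 mat_def)
next
  case (Suc k)
  have "\<bar>mpower A (Suc k) $ x $ y\<bar> \<le> (\<Sum>z\<in>UNIV. \<bar>A $ x $ z\<bar> * \<bar>mpower A k $ z $ y\<bar>)"
    unfolding mpower_Suc_nth abs_mult[symmetric] by (rule sum_abs)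
  also have "\<dots> \<le> (\<Sum>z\<in>UNIV. \<bar>A $ x $ z\<bar> * ?M ^ k)"
    by (intro sum_mono mult_left_mono Suc.IH) simp
  also have "\<dots> = (\<Sum>z\<in>UNIV. \<bar>A $ x $ z\<bar>) * ?M ^ k"
    by (simp add: sum_distrib_right)
  also have "(\<Sum>z\<in>UNIV. \<bar>A $ x $ z\<bar>) \<le> ?M"
    by (rule member_le_sum[where f = "\<lambda>x. \<Sum>z\<in>UNIV. \<bar>A $ x $ z\<bar>"]) (auto intro: sum_nonneg)
  finally show ?case
    by (simp add: mult_right_mono sum_nonneg)
qed

lemma summable_mpower_nth:
  fixes A :: "real ^ 'n ^ 'n"
  shows "summable (\<lambda>k. mpower A k $ x $ y / fact k * t ^ k)"
proof (rule summable_comparison_test)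
  define M where "M = (\<Sum>x\<in>UNIV. \<Sum>y\<in>UNIV. \<bar>A $ x $ y\<bar>)"
  show "\<exists>N. \<forall>k\<ge>N. norm (mpower A k $ x $ y / fact k * t ^ k) \<le> inverse (fact k) * (M * \<bar>t\<bar>) ^ k"
  proof (intro exI allI impI)
    fix k :: nat
    have "\<bar>mpower A k $ x $ y\<bar> * \<bar>t\<bar> ^ k \<le> M ^ k * \<bar>t\<bar> ^ k"
      unfolding M_def by (intro mult_right_mono abs_mpower_nth_le) simp
    then have "\<bar>mpower A k $ x $ y\<bar> * \<bar>t\<bar> ^ k / fact k \<le> M ^ k * \<bar>t\<bar> ^ k / fact k"
      by (rule divide_right_mono) simp
    then show "norm (mpower A k $ x $ y / fact k * t ^ k) \<le> inverse (fact k) * (M * \<bar>t\<bar>) ^ k"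
      by (simp add: abs_mult power_abs power_mult_distrib divide_inverse mult_ac)
  qed
  show "summable (\<lambda>k. inverse (fact k) * (M * \<bar>t\<bar>) ^ k)"
    by (rule summable_exp)
qed

lemma matrix_exp_nth:
  fixes A :: "real ^ 'n ^ 'n"
  shows "matrix_exp (t *\<^sub>R A) $ x $ y = (\<Sum>k. mpower A k $ x $ y / fact k * t ^ k)"
proof -
  define S :: "real ^ 'n ^ 'n" where "S = (\<chi> x y. \<Sum>k. mpower A k $ x $ y / fact k * t ^ k)"
  have "(\<lambda>k. (1 / fact k) *\<^sub>R mpower (t *\<^sub>R A) k) sums S"
    unfolding sums_def
  proof (intro vec_tendstoI)
    fix x y
    have "(\<lambda>k. mpower A k $ x $ y / fact k * t ^ k) sums (S $ x $ y)"
      unfolding S_def using summable_sums[OF summable_mpower_nth] by simp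
    then show "(\<lambda>n. (\<Sum>k<n. (1 / fact k) *\<^sub>R mpower (t *\<^sub>R A) k) $ x $ y) \<longlonglongrightarrow> S $ x $ y"
      by (simp add: sums_def mpower_scaleR mult_ac)
  qed
  then have "matrix_exp (t *\<^sub>R A) = S"
    unfolding matrix_exp_def mpower_def[symmetric] by (rule sums_unique[symmetric])
  then show ?thesis
    by (simp add: S_def)
qed

lemma matrix_exp_tendsto:
  fixes A :: "real ^ 'n ^ 'n"
  shows "((\<lambda>t. (matrix_exp (t *\<^sub>R A) $ x $ y - (if x = y then 1 else 0)) / t) \<longlongrightarrow> A $ x $ y) (at_right 0)"
proof -
  define c where "c k = mpower A k $ x $ y / fact k" for k
  have "((\<lambda>t. \<Sum>k. c k * t ^ k) has_real_derivative (\<Sum>k. diffs c k * 0 ^ k)) (at 0)"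
    by (rule termdiffs_strong_converges_everywhere) (unfold c_def, rule summable_mpower_nth)
  moreover have "(\<Sum>k. diffs c k * 0 ^ k) = A $ x $ y"
    by (simp only: powser_zero) (simp add: diffs_def c_def mpower_Suc_nth mpower_0 mat_def if_distrib cong: if_cong)
  ultimately have "((\<lambda>t. ((\<Sum>k. c k * (0 + t) ^ k) - (\<Sum>k. c k * 0 ^ k)) / t) \<longlongrightarrow> A $ x $ y) (at 0)"
    by (simp add: DERIV_def)
  moreover have "(\<Sum>k. c k * 0 ^ k) = (if x = y then 1 else 0)"
    by (simp only: powser_zero) (simp add: c_def mpower_0 mat_def)
  ultimately have "((\<lambda>t. (matrix_exp (t *\<^sub>R A) $ x $ y - (if x = y then 1 else 0)) / t) \<longlongrightarrow> A $ x $ y) (at 0)"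
    by (simp add: c_def matrix_exp_nth)
  then show ?thesis
    by (rule tendsto_mono[OF at_le, rotated]) simp
qed

lemma gen_matrix_nth:
  "gen_matrix w $ x $ y = (\<Sum>z\<in>UNIV. w x z * ((if z = y then 1 else 0) - (if x = y then 1 else 0)))"
  by (simp add: gen_matrix_def matrix_def generator_def axis_def)

lemma gen_matrix_apply:
  "(\<Sum>y\<in>UNIV. gen_matrix w $ x $ y * h y) = (\<Sum>z\<in>UNIV. w x z * (h z - h x))"
proof -
  have "(\<Sum>y\<in>UNIV. gen_matrix w $ x $ y * h y) =
      (\<Sum>z\<in>UNIV. w x z * (\<Sum>y\<in>UNIV. ((if z = y then h y else 0) - (if x = y then h y else 0))))"
    unfolding gen_matrix_nth sum_distrib_right sum_distrib_left
    by (subst sum.swap) (intro sum.cong refl, auto simp: algebra_simps)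
  then show ?thesis
    by (simp add: sum_subtractf)
qed

section \<open>Mean hitting times\<close>

definition trans_prob :: "('a::finite \<Rightarrow> 'a \<Rightarrow> real) \<Rightarrow> real \<Rightarrow> 'a \<Rightarrow> 'a \<Rightarrow> real" where
  "trans_prob w d x y = matrix_exp (d *\<^sub>R gen_matrix w) $ x $ y"

lemma trans_prob_poisson:
  fixes w :: "'a::finite \<Rightarrow> 'a \<Rightarrow> real"
  shows "((\<lambda>d. (h x - (\<Sum>y\<in>UNIV. trans_prob w d x y * h y)) / d) \<longlongrightarrow>
    - (\<Sum>z\<in>UNIV. w x z * (h z - h x))) (at_right 0)"
proof -
  have "((\<lambda>d. - (\<Sum>y\<in>UNIV. (trans_prob w d x y - (if x = y then 1 else 0)) / d * h y)) \<longlongrightarrow>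
      - (\<Sum>y\<in>UNIV. gen_matrix w $ x $ y * h y)) (at_right 0)"
    unfolding trans_prob_def by (intro tendsto_intros matrix_exp_tendsto)
  moreover have "- (\<Sum>y\<in>UNIV. (trans_prob w d x y - (if x = y then 1 else 0)) / d * h y) =
      (h x - (\<Sum>y\<in>UNIV. trans_prob w d x y * h y)) / d" for d
  proof -
    have "(\<Sum>y\<in>UNIV. (trans_prob w d x y - (if x = y then 1 else 0)) / d * h y) =
        (\<Sum>y\<in>UNIV. (trans_prob w d x y * h y - (if x = y then h y else 0)) / d)"
      by (intro sum.cong) (auto simp: algebra_simps)
    also have "\<dots> = ((\<Sum>y\<in>UNIV. trans_prob w d x y * h y) - h x) / d"
      by (simp add: sum_divide_distrib[symmetric] sum_subtractf)
    finally show ?thesis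
      by (simp add: minus_divide_left)
  qed
  ultimately show ?thesis
    by (simp add: gen_matrix_apply)
qed

definition avoids :: "(real \<Rightarrow> 'w \<Rightarrow> 'a) \<Rightarrow> 'a set \<Rightarrow> real \<Rightarrow> nat \<Rightarrow> 'w \<Rightarrow> bool" where
  "avoids X R d j \<omega> \<longleftrightarrow> (\<forall>i\<le>j. X (real i * d) \<omega> \<notin> R)"

text \<open>The hitting time of \<open>R\<close> by the process observed at the multiples of \<open>d\<close> only.\<close>

definition grid_time :: "(real \<Rightarrow> 'w \<Rightarrow> 'a) \<Rightarrow> 'a set \<Rightarrow> real \<Rightarrow> 'w \<Rightarrow> ennreal" where
  "grid_time X R d \<omega> = (\<Sum>j. ennreal d * (if avoids X R d j \<omega> then 1 else 0))"

lemma grid_time_le: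
  assumes "0 \<le> d" "X (real j * d) \<omega> \<in> R"
  shows "grid_time X R d \<omega> \<le> ennreal (real j * d)"
proof -
  have "\<not> avoids X R d i \<omega>" if "j \<le> i" for i
    using assms(2) that by (auto simp: avoids_def)
  then have "grid_time X R d \<omega> = (\<Sum>i<j. ennreal d * (if avoids X R d i \<omega> then 1 else 0))"
    unfolding grid_time_def by (intro suminf_finite) auto
  also have "\<dots> \<le> (\<Sum>i<j. ennreal d)"
    by (intro sum_mono) auto
  also have "\<dots> = ennreal (real j * d)"
    using assms(1) by (simp add: ennreal_mult ennreal_of_nat_eq_real_of_nat)
  finally show ?thesis .
qed

lemma grid_time_cases:
  assumes "0 < d"
  obtains "grid_time X R d \<omega> = \<infinity>"
  | j where "X (real j * d) \<omega> \<in> R" "grid_time X R d \<omega> = ennreal (real j * d)"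
proof (cases "\<exists>j. X (real j * d) \<omega> \<in> R")
  case False
  then have "grid_time X R d \<omega> = (\<Sum>j::nat. ennreal d)"
    unfolding grid_time_def avoids_def by simp
  also have "\<dots> = \<infinity>"
  proof (rule ccontr)
    assume "(\<Sum>j::nat. ennreal d) \<noteq> \<infinity>"
    then have "summable (\<lambda>_::nat. d)"
      using assms by (intro summable_suminf_not_top) auto
    with assms show False
      by (simp add: summable_const_iff)
  qed
  finally show ?thesis
    using that(1) by blast
next
  case True
  define j where "j = (LEAST j. X (real j * d) \<omega> \<in> R)"
  have j: "X (real j * d) \<omega> \<in> R"
    unfolding j_def by (rule LeastI_ex[OF True])
  have av: "avoids X R d i \<omega>" if "i < j" for i
    using that not_less_Least unfolding avoids_def j_def by (meson order.strict_trans1)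
  have "ennreal (real j * d) = (\<Sum>i<j. ennreal d * (if avoids X R d i \<omega> then 1 else 0))"
    using av assms by (simp add: ennreal_mult ennreal_of_nat_eq_real_of_nat)
  also have "\<dots> \<le> grid_time X R d \<omega>"
    unfolding grid_time_def by (intro sum_le_suminf) auto
  finally have "grid_time X R d \<omega> = ennreal (real j * d)"
    using grid_time_le[of d X j \<omega> R] j assms by (simp add: antisym)
  with j show ?thesis
    using that(2) by blast
qed

lemma hitting_time_le_grid_time:
  assumes "0 < d"
  shows "hitting_time X R \<omega> \<le> grid_time X R d \<omega>"
proof (cases rule: grid_time_cases[OF assms, of X R \<omega>])
  case (2 j)
  have "hitting_time X R \<omega> \<le> ennreal (real j * d)"
    unfolding hitting_time_def using 2(1) assms by (intro Inf_lower imageI) simp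
  with 2(2) show ?thesis
    by simp
qed simp

lemma decseq_grid_time: "decseq (\<lambda>k. grid_time X R ((1 / 2) ^ k) \<omega>)"
proof (rule decseq_SucI)
  fix k :: nat
  have pos: "0 < (1 / 2 :: real) ^ k"
    by simp
  show "grid_time X R ((1 / 2) ^ Suc k) \<omega> \<le> grid_time X R ((1 / 2) ^ k) \<omega>"
  proof (cases rule: grid_time_cases[OF pos, of X R \<omega>])
    case (2 j)
    have "real (2 * j) * (1 / 2) ^ Suc k = real j * (1 / 2) ^ k"
      by simp
    then show ?thesis
      using grid_time_le[of "(1 / 2) ^ Suc k" X "2 * j" \<omega> R] 2 by simp
  qed simp
qed

lemma hitting_time_eq_INF_grid_time:
  assumes rc: "\<And>t. 0 \<le> t \<Longrightarrow> \<forall>\<^sub>F s in at_right t. X s \<omega> = X t \<omega>"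
  shows "hitting_time X R \<omega> = (INF k. grid_time X R ((1 / 2) ^ k) \<omega>)"
proof (rule antisym)
  show "hitting_time X R \<omega> \<le> (INF k. grid_time X R ((1 / 2) ^ k) \<omega>)"
    by (intro INF_greatest hitting_time_le_grid_time) simp
  show "(INF k. grid_time X R ((1 / 2) ^ k) \<omega>) \<le> hitting_time X R \<omega>"
    unfolding hitting_time_def
  proof (intro Inf_greatest; clarify)
    fix t :: real assume t: "0 \<le> t" "X t \<omega> \<in> R"
    obtain b where b: "b > t" "\<And>s. t < s \<Longrightarrow> s < b \<Longrightarrow> X s \<omega> = X t \<omega>"
      using rc[OF t(1)] unfolding eventually_at_right_field by blast
    show "(INF k. grid_time X R ((1 / 2) ^ k) \<omega>) \<le> ennreal t"
    proof (rule ennreal_le_epsilon)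
      fix e :: real assume e: "0 < e"
      obtain k where k: "(1 / 2 :: real) ^ k < min e (b - t)"
        using real_arch_pow_inv[of "min e (b - t)" "1 / 2"] e b(1) by auto
      define d where "d = (1 / 2 :: real) ^ k"
      have d: "0 < d" "d < e" "t + d < b"
        using k by (auto simp: d_def)
      define j where "j = nat \<lceil>t / d\<rceil>"
      have "real j = of_int \<lceil>t / d\<rceil>"
        using t d by (simp add: j_def)
      then have "t / d \<le> real j" "real j < t / d + 1"
        by linarith+
      then have j: "t \<le> real j * d" "real j * d < t + d"
        using d by (simp_all add: field_simps)
      have "X (real j * d) \<omega> = X t \<omega>"
        using b(2)[of "real j * d"] j d(3) by (cases "real j * d = t") auto
      with t(2) have "grid_time X R d \<omega> \<le> ennreal (real j * d)"
        using d by (intro grid_time_le) auto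
      also have "\<dots> \<le> ennreal (t + e)"
        using j d by (intro ennreal_leI) simp
      also have "\<dots> = ennreal t + ennreal e"
        using t e by simp
      finally show "(INF k. grid_time X R ((1 / 2) ^ k) \<omega>) \<le> ennreal t + ennreal e"
        unfolding d_def by (rule INF_lower2[OF UNIV_I])
    qed
  qed
qed

context
  fixes w :: "'a::finite \<Rightarrow> 'a \<Rightarrow> real" and P :: "'a \<Rightarrow> 'w measure" and X :: "real \<Rightarrow> 'w \<Rightarrow> 'a"
  assumes process: "\<And>x. markov_process_from w x (P x) X"
begin

lemma prob_space_process: "prob_space (P x)"
  using process by (simp add: markov_process_from_def)

lemma measurable_process: "0 \<le> t \<Longrightarrow> X t \<in> measurable (P x) (count_space UNIV)"
  using process[of x] by (simp add: markov_process_from_def)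

lemma right_continuous_process:
  "\<omega> \<in> space (P x) \<Longrightarrow> 0 \<le> t \<Longrightarrow> \<forall>\<^sub>F s in at_right t. X s \<omega> = X t \<omega>"
  using process[of x] by (simp add: markov_process_from_def)

definition cylinder :: "'a \<Rightarrow> real \<Rightarrow> nat \<Rightarrow> (nat \<Rightarrow> 'a) \<Rightarrow> 'w set" where
  "cylinder x d j z = {\<omega> \<in> space (P x). \<forall>i\<le>j. X (real i * d) \<omega> = z i}"

lemma measurable_state[measurable]:
  "0 \<le> d \<Longrightarrow> Measurable.pred (P x) (\<lambda>\<omega>. X (real i * d) \<omega> = y)"
  "0 \<le> d \<Longrightarrow> Measurable.pred (P x) (\<lambda>\<omega>. X (real i * d) \<omega> \<in> R)"
  using measurable_process[of "real i * d" x] by (auto intro: measurable_compose)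

lemma cylinder_sets: "0 \<le> d \<Longrightarrow> cylinder x d j z \<in> sets (P x)"
  unfolding cylinder_def by measurable

lemma measure_cylinder:
  assumes "0 \<le> d"
  shows "measure (P x) (cylinder x d j z) =
    (if z 0 = x then 1 else 0) * (\<Prod>i<j. trans_prob w d (z i) (z (Suc i)))"
proof -
  have *: "t 0 = 0 \<Longrightarrow> (\<forall>i<k. t i \<le> t (Suc i)) \<Longrightarrow>
        measure (P x) {\<omega> \<in> space (P x). \<forall>i\<le>k. X (t i) \<omega> = z i} =
          (if z 0 = x then 1 else 0) *
          (\<Prod>i<k. matrix_exp ((t (Suc i) - t i) *\<^sub>R gen_matrix w) $ z i $ z (Suc i))" for k t
    using process[of x] unfolding markov_process_from_def by blast
  have "real (Suc i) * d - real i * d = d" for i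
    by (simp add: algebra_simps)
  then show ?thesis
    using *[of "\<lambda>i. real i * d" j] assms
    by (simp add: cylinder_def trans_prob_def mult_right_mono del: of_nat_Suc)
qed

definition taboo :: "'a set \<Rightarrow> 'a \<Rightarrow> real \<Rightarrow> nat \<Rightarrow> 'a \<Rightarrow> real" where
  "taboo R x d j y = measure (P x) {\<omega> \<in> space (P x). avoids X R d j \<omega> \<and> X (real j * d) \<omega> = y}"

definition survival :: "'a set \<Rightarrow> 'a \<Rightarrow> real \<Rightarrow> nat \<Rightarrow> real" where
  "survival R x d j = measure (P x) {\<omega> \<in> space (P x). avoids X R d j \<omega>}"

lemma avoids_sets: "0 \<le> d \<Longrightarrow> {\<omega> \<in> space (P x). avoids X R d j \<omega>} \<in> sets (P x)"
  unfolding avoids_def by measurable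

lemma taboo_sets: "0 \<le> d \<Longrightarrow> {\<omega> \<in> space (P x). avoids X R d j \<omega> \<and> X (real j * d) \<omega> = y} \<in> sets (P x)"
  unfolding avoids_def by measurable

lemma survival_eq:
  assumes "0 \<le> d"
  shows "survival R x d j = (\<Sum>y\<in>- R. taboo R x d j y)"
proof -
  interpret prob_space "P x"
    by (rule prob_space_process)
  have "{\<omega> \<in> space (P x). avoids X R d j \<omega>} =
      (\<Union>y\<in>- R. {\<omega> \<in> space (P x). avoids X R d j \<omega> \<and> X (real j * d) \<omega> = y})"
    by (auto simp: avoids_def)
  then show ?thesis
    unfolding survival_def taboo_def using taboo_sets[OF assms]
    by (simp only:) (intro finite_measure_finite_Union, auto simp: disjoint_family_on_def)
qed

lemma taboo_eq_sum:
  assumes "0 \<le> d"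
  shows "taboo R x d j y =
    (\<Sum>z\<in>{z \<in> {..j} \<rightarrow>\<^sub>E - R. z j = y}. measure (P x) (cylinder x d j z))"
proof -
  interpret prob_space "P x"
    by (rule prob_space_process)
  have "{\<omega> \<in> space (P x). avoids X R d j \<omega> \<and> X (real j * d) \<omega> = y} =
      (\<Union>z\<in>{z \<in> {..j} \<rightarrow>\<^sub>E - R. z j = y}. cylinder x d j z)" (is "?A = ?B")
  proof
    show "?B \<subseteq> ?A"
      by (auto simp: cylinder_def avoids_def PiE_iff)
    show "?A \<subseteq> ?B"
    proof
      fix \<omega> assume "\<omega> \<in> ?A"
      then have "restrict (\<lambda>i. X (real i * d) \<omega>) {..j} \<in> {z \<in> {..j} \<rightarrow>\<^sub>E - R. z j = y}"
        "\<omega> \<in> cylinder x d j (restrict (\<lambda>i. X (real i * d) \<omega>) {..j})"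
        by (auto simp: cylinder_def avoids_def)
      then show "\<omega> \<in> ?B"
        by blast
    qed
  qed
  moreover have "disjoint_family_on (cylinder x d j) {z \<in> {..j} \<rightarrow>\<^sub>E - R. z j = y}"
  proof (clarsimp simp: disjoint_family_on_def)
    fix z z' assume "z \<in> {..j} \<rightarrow>\<^sub>E - R" "z' \<in> {..j} \<rightarrow>\<^sub>E - R" "z \<noteq> z'"
    then obtain i where "i \<le> j" "z i \<noteq> z' i"
      by (metis PiE_ext atMost_iff)
    then show "cylinder x d j z \<inter> cylinder x d j z' = {}"
      by (auto simp: cylinder_def)
  qed
  moreover have "finite {z \<in> {..j} \<rightarrow>\<^sub>E - R. z j = y}"
    by (rule finite_subset[of _ "{..j} \<rightarrow>\<^sub>E - R"]) (auto intro: finite_PiE)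
  ultimately show ?thesis
    unfolding taboo_def using cylinder_sets[OF assms]
    by (simp only:) (intro finite_measure_finite_Union, auto)
qed

lemma taboo_Suc:
  assumes "0 \<le> d" "y \<in> - R"
  shows "taboo R x d (Suc j) y = (\<Sum>y'\<in>- R. taboo R x d j y' * trans_prob w d y' y)"
proof -
  interpret prob_space "P x"
    by (rule prob_space_process)
  have fin: "finite ({..j} \<rightarrow>\<^sub>E - R)"
    by (intro finite_PiE) auto
  have "{\<omega> \<in> space (P x). avoids X R d (Suc j) \<omega> \<and> X (real (Suc j) * d) \<omega> = y} =
      (\<Union>z\<in>{..j} \<rightarrow>\<^sub>E - R. cylinder x d (Suc j) (z(Suc j := y)))" (is "?A = ?B")
  proof
    show "?B \<subseteq> ?A"
      using assms(2) by (auto simp: cylinder_def avoids_def PiE_iff le_Suc_eq)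
    show "?A \<subseteq> ?B"
    proof
      fix \<omega> assume "\<omega> \<in> ?A"
      then have "restrict (\<lambda>i. X (real i * d) \<omega>) {..j} \<in> {..j} \<rightarrow>\<^sub>E - R"
        "\<omega> \<in> cylinder x d (Suc j) ((restrict (\<lambda>i. X (real i * d) \<omega>) {..j})(Suc j := y))"
        by (auto simp: cylinder_def avoids_def le_Suc_eq)
      then show "\<omega> \<in> ?B"
        by blast
    qed
  qed
  moreover have "disjoint_family_on (\<lambda>z. cylinder x d (Suc j) (z(Suc j := y))) ({..j} \<rightarrow>\<^sub>E - R)"
  proof (clarsimp simp: disjoint_family_on_def)
    fix z z' assume "z \<in> {..j} \<rightarrow>\<^sub>E - R" "z' \<in> {..j} \<rightarrow>\<^sub>E - R" "z \<noteq> z'"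
    then obtain i where i: "i \<le> j" "z i \<noteq> z' i"
      by (metis PiE_ext atMost_iff)
    show "cylinder x d (Suc j) (z(Suc j := y)) \<inter> cylinder x d (Suc j) (z'(Suc j := y)) = {}"
    proof (rule ccontr)
      assume "\<not> ?thesis"
      then obtain \<omega> where "\<forall>k\<le>Suc j. X (real k * d) \<omega> = (z(Suc j := y)) k"
          "\<forall>k\<le>Suc j. X (real k * d) \<omega> = (z'(Suc j := y)) k"
        unfolding cylinder_def by blast
      then have "(z(Suc j := y)) i = (z'(Suc j := y)) i"
        using i(1) by (metis le_SucI)
      with i show False
        by simp
    qed
  qed
  ultimately have "taboo R x d (Suc j) y =
      (\<Sum>z\<in>{..j} \<rightarrow>\<^sub>E - R. measure (P x) (cylinder x d (Suc j) (z(Suc j := y))))"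
    unfolding taboo_def using cylinder_sets[OF assms(1)] fin
    by (simp only:) (intro finite_measure_finite_Union, auto)
  also have "\<dots> = (\<Sum>z\<in>{..j} \<rightarrow>\<^sub>E - R. measure (P x) (cylinder x d j z) * trans_prob w d (z j) y)"
    by (intro sum.cong refl) (simp add: measure_cylinder[OF assms(1)])
  also have "\<dots> = (\<Sum>y'\<in>- R. \<Sum>z\<in>{z \<in> {..j} \<rightarrow>\<^sub>E - R. z j = y'}.
      measure (P x) (cylinder x d j z) * trans_prob w d (z j) y)"
    by (rule sum.group[symmetric]) (use fin in auto)
  also have "\<dots> = (\<Sum>y'\<in>- R. taboo R x d j y' * trans_prob w d y' y)"
    by (intro sum.cong refl) (simp add: taboo_eq_sum[OF assms(1)] sum_distrib_right)
  finally show ?thesis .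
qed

lemma taboo_0:
  assumes "y \<in> - R"
  shows "taboo R x d 0 y = (if y = x then 1 else 0)"
proof -
  have "{\<omega> \<in> space (P x). avoids X R d 0 \<omega> \<and> X (real 0 * d) \<omega> = y} = cylinder x 0 0 (\<lambda>_. y)"
    using assms by (auto simp: avoids_def cylinder_def)
  then show ?thesis
    unfolding taboo_def by (simp only:) (simp add: measure_cylinder)
qed

lemma nn_integral_grid_time:
  assumes "0 \<le> d"
  shows "(\<integral>\<^sup>+ \<omega>. grid_time X R d \<omega> \<partial>P x) = (\<Sum>j. ennreal (d * survival R x d j))"
    and "grid_time X R d \<in> borel_measurable (P x)"
proof -
  interpret prob_space "P x"
    by (rule prob_space_process)
  have eq: "grid_time X R d \<omega> =
      (\<Sum>j. ennreal d * indicator {\<omega> \<in> space (P x). avoids X R d j \<omega>} \<omega>)" if "\<omega> \<in> space (P x)" for \<omega>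
    unfolding grid_time_def using that by (intro suminf_cong) (auto simp: indicator_def)
  have meas: "(\<lambda>\<omega>. ennreal d * indicator {\<omega> \<in> space (P x). avoids X R d j \<omega>} \<omega>) \<in> borel_measurable (P x)" for j
    using avoids_sets[OF assms] by measurable
  have "(\<integral>\<^sup>+ \<omega>. grid_time X R d \<omega> \<partial>P x) =
      (\<integral>\<^sup>+ \<omega>. (\<Sum>j. ennreal d * indicator {\<omega> \<in> space (P x). avoids X R d j \<omega>} \<omega>) \<partial>P x)"
    by (intro nn_integral_cong eq)
  also have "\<dots> = (\<Sum>j. \<integral>\<^sup>+ \<omega>. ennreal d * indicator {\<omega> \<in> space (P x). avoids X R d j \<omega>} \<omega> \<partial>P x)"
    by (rule nn_integral_suminf[OF meas])
  also have "\<dots> = (\<Sum>j. ennreal (d * survival R x d j))"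
    using assms by (intro suminf_cong)
      (simp add: nn_integral_cmult_indicator[OF avoids_sets[OF assms]] survival_def emeasure_eq_measure ennreal_mult)
  finally show "(\<integral>\<^sup>+ \<omega>. grid_time X R d \<omega> \<partial>P x) = (\<Sum>j. ennreal (d * survival R x d j))" .
  have "(\<lambda>\<omega>. \<Sum>j. ennreal d * indicator {\<omega> \<in> space (P x). avoids X R d j \<omega>} \<omega>) \<in> borel_measurable (P x)"
    by (intro borel_measurable_suminf_order meas)
  then show "grid_time X R d \<in> borel_measurable (P x)"
    by (subst measurable_cong[OF eq])
qed

text \<open>
  With \<open>h\<close> the solution of the Poisson equation, \<open>h\<close> summed against the taboo probabilities
  decreases in one step of length \<open>d\<close> by \<open>d\<close> times the survival probability, up to a factor close to
  1. Telescoping determines the mean hitting time along the grid up to the same factor.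
\<close>

lemma grid_time_bounds:
  assumes d: "0 < d" and e: "0 < e" "e < 1"
    and h: "\<And>x. 0 \<le> h x" "\<And>x. x \<in> R \<Longrightarrow> h x = 0"
    and step: "\<And>x. x \<notin> R \<Longrightarrow> \<bar>(h x - (\<Sum>y\<in>UNIV. trans_prob w d x y * h y)) / d - 1\<bar> \<le> e"
  shows "\<exists>m. (\<integral>\<^sup>+ \<omega>. grid_time X R d \<omega> \<partial>P x) = ennreal m \<and> (1 - e) * m \<le> h x \<and> h x \<le> (1 + e) * m"
proof -
  define H where "H j = (\<Sum>y\<in>- R. taboo R x d j y * h y)" for j
  define s where "s j = survival R x d j" for j
  have taboo_nonneg: "0 \<le> taboo R x d j y" for j y
    by (simp add: taboo_def)
  have s_eq: "s j = (\<Sum>y\<in>- R. taboo R x d j y)" for j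
    unfolding s_def using survival_eq d by simp
  have s_nonneg: "0 \<le> s j" for j
    by (simp add: s_def survival_def)
  have H_nonneg: "0 \<le> H j" for j
    unfolding H_def by (intro sum_nonneg mult_nonneg_nonneg taboo_nonneg h)
  have H0: "H 0 = h x"
  proof -
    have "H 0 = (\<Sum>y\<in>- R. if y = x then h y else 0)"
      unfolding H_def by (intro sum.cong) (auto simp: taboo_0)
    then show ?thesis
      using h(2) by simp
  qed
  have off: "(\<Sum>y\<in>UNIV. trans_prob w d y' y * h y) = (\<Sum>y\<in>- R. trans_prob w d y' y * h y)" for y'
    by (rule sum.mono_neutral_right) (auto simp: h(2))
  have HS: "H j - H (Suc j) =
      (\<Sum>y\<in>- R. taboo R x d j y * (h y - (\<Sum>z\<in>UNIV. trans_prob w d y z * h z)))" for j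
  proof -
    have "H (Suc j) = (\<Sum>z\<in>- R. \<Sum>y\<in>- R. taboo R x d j y * (trans_prob w d y z * h z))"
      unfolding H_def using d by (intro sum.cong refl) (simp add: taboo_Suc sum_distrib_right mult.assoc)
    also have "\<dots> = (\<Sum>y\<in>- R. taboo R x d j y * (\<Sum>z\<in>UNIV. trans_prob w d y z * h z))"
      unfolding off sum_distrib_left by (rule sum.swap)
    finally show ?thesis
      by (simp add: H_def right_diff_distrib sum_subtractf)
  qed
  have bd: "d * (1 - e) \<le> h y - (\<Sum>z\<in>UNIV. trans_prob w d y z * h z)"
    "h y - (\<Sum>z\<in>UNIV. trans_prob w d y z * h z) \<le> d * (1 + e)" if "y \<in> - R" for y
    using step[of y] that d by (auto simp: abs_le_iff field_simps)
  have lower: "(1 - e) * (d * s j) \<le> H j - H (Suc j)" for j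
  proof -
    have "(1 - e) * (d * s j) = (\<Sum>y\<in>- R. taboo R x d j y * (d * (1 - e)))"
      by (simp add: s_eq sum_distrib_left mult_ac)
    also have "\<dots> \<le> H j - H (Suc j)"
      unfolding HS by (intro sum_mono mult_left_mono bd taboo_nonneg)
    finally show ?thesis .
  qed
  have upper: "H j - H (Suc j) \<le> (1 + e) * (d * s j)" for j
  proof -
    have "H j - H (Suc j) \<le> (\<Sum>y\<in>- R. taboo R x d j y * (d * (1 + e)))"
      unfolding HS by (intro sum_mono mult_left_mono bd taboo_nonneg)
    also have "\<dots> = (1 + e) * (d * s j)"
      by (simp add: s_eq sum_distrib_left mult_ac)
    finally show ?thesis .
  qed
  have tel: "(\<Sum>j<n. H j - H (Suc j)) = h x - H n" for n
    using sum_lessThan_telescope'[of H n] H0 by simp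
  have low_n: "(1 - e) * (\<Sum>j<n. d * s j) \<le> h x" for n
  proof -
    have "(1 - e) * (\<Sum>j<n. d * s j) \<le> (\<Sum>j<n. H j - H (Suc j))"
      unfolding sum_distrib_left by (intro sum_mono lower)
    then show ?thesis
      unfolding tel using H_nonneg[of n] by linarith
  qed
  have summ: "summable (\<lambda>j. d * s j)"
  proof (rule bounded_imp_summable)
    show "0 \<le> d * s n" for n
      using d s_nonneg by simp
    show "(\<Sum>k\<le>n. d * s k) \<le> h x / (1 - e)" for n
      using low_n[of "Suc n"] e by (simp add: field_simps lessThan_Suc_atMost)
  qed
  define m where "m = (\<Sum>j. d * s j)"
  have sums: "(\<lambda>n. \<Sum>j<n. d * s j) \<longlonglongrightarrow> m"
    unfolding m_def by (rule summable_LIMSEQ[OF summ])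
  have "(\<integral>\<^sup>+ \<omega>. grid_time X R d \<omega> \<partial>P x) = ennreal m"
    unfolding m_def using d nn_integral_grid_time(1)[where d = d and R = R and x = x] s_nonneg summ
    by (simp add: s_def suminf_ennreal_eq[OF _ summable_sums[OF summ[unfolded s_def]]])
  moreover have "(1 - e) * m \<le> h x"
    by (rule LIMSEQ_le_const2[OF tendsto_mult_left[OF sums]]) (use low_n in auto)
  moreover have "h x \<le> (1 + e) * m"
  proof -
    have "(\<lambda>j. d * s j) \<longlonglongrightarrow> 0"
      by (rule summable_LIMSEQ_zero[OF summ])
    then have s0: "s \<longlonglongrightarrow> 0"
      using d tendsto_mult_left_iff[of d s 0 sequentially] by simp
    have "H n \<le> (\<Sum>y\<in>UNIV. h y) * s n" for n
    proof -
      have "h y \<le> (\<Sum>y\<in>UNIV. h y)" for y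
        by (rule member_le_sum) (auto simp: h)
      then have "H n \<le> (\<Sum>y\<in>- R. taboo R x d n y * (\<Sum>y\<in>UNIV. h y))"
        unfolding H_def by (intro sum_mono mult_left_mono taboo_nonneg)
      then show ?thesis
        unfolding sum_distrib_right[symmetric] s_eq by (simp only: mult.commute)
    qed
    then have "h x \<le> (1 + e) * (\<Sum>j<n. d * s j) + (\<Sum>y\<in>UNIV. h y) * s n" for n
    proof -
      have "(\<Sum>j<n. H j - H (Suc j)) \<le> (1 + e) * (\<Sum>j<n. d * s j)"
        unfolding sum_distrib_left by (intro sum_mono upper)
      then show ?thesis
        unfolding tel using \<open>H n \<le> (\<Sum>y\<in>UNIV. h y) * s n\<close> by linarith
    qed
    moreover have "(\<lambda>n. (1 + e) * (\<Sum>j<n. d * s j) + (\<Sum>y\<in>UNIV. h y) * s n) \<longlonglongrightarrow>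
        (1 + e) * m + (\<Sum>y\<in>UNIV. h y) * 0"
      by (intro tendsto_intros sums s0)
    ultimately have "h x \<le> (1 + e) * m + (\<Sum>y\<in>UNIV. h y) * 0"
      by (intro LIMSEQ_le_const) auto
    then show ?thesis
      by simp
  qed
  ultimately show ?thesis
    by blast
qed

lemma mean_hitting_time_eq:
  assumes h: "\<And>x. 0 \<le> h x" "\<And>x. x \<in> R \<Longrightarrow> h x = 0"
    and poisson: "\<And>x. x \<notin> R \<Longrightarrow> (\<Sum>z\<in>UNIV. w x z * (h z - h x)) = - 1"
  shows "mean_hitting_time (P x) X R = ennreal (h x)"
proof -
  define g where "g k = (\<integral>\<^sup>+ \<omega>. grid_time X R ((1 / 2) ^ k) \<omega> \<partial>P x)" for k :: nat
  have lim0: "filterlim (\<lambda>k. (1 / 2 :: real) ^ k) (at_right 0) sequentially"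
    unfolding filterlim_at by (auto intro: LIMSEQ_power_zero)
  have ev: "\<forall>\<^sub>F k in sequentially. \<exists>m. g k = ennreal m \<and> (1 - e) * m \<le> h x \<and> h x \<le> (1 + e) * m"
    if e: "0 < e" "e < 1" for e
  proof -
    have "\<forall>\<^sub>F d in at_right 0. \<forall>x\<in>- R. \<bar>(h x - (\<Sum>y\<in>UNIV. trans_prob w d x y * h y)) / d - 1\<bar> \<le> e"
    proof (rule eventually_ball_finite; safe?)
      fix x assume "x \<notin> R"
      then have "((\<lambda>d. (h x - (\<Sum>y\<in>UNIV. trans_prob w d x y * h y)) / d) \<longlongrightarrow> 1) (at_right 0)"
        using trans_prob_poisson[of h x w] poisson by simp
      then have "\<forall>\<^sub>F d in at_right 0. dist ((h x - (\<Sum>y\<in>UNIV. trans_prob w d x y * h y)) / d) 1 < e"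
        using e(1) by (rule tendstoD)
      then show "\<forall>\<^sub>F d in at_right 0. \<bar>(h x - (\<Sum>y\<in>UNIV. trans_prob w d x y * h y)) / d - 1\<bar> \<le> e"
        by eventually_elim (simp add: dist_real_def)
    qed simp
    then have "\<forall>\<^sub>F k in sequentially. \<forall>x\<in>- R.
        \<bar>(h x - (\<Sum>y\<in>UNIV. trans_prob w ((1 / 2) ^ k) x y * h y)) / (1 / 2) ^ k - 1\<bar> \<le> e"
      by (rule eventually_compose_filterlim[OF _ lim0])
    then show ?thesis
      unfolding g_def by eventually_elim (use e h in \<open>intro grid_time_bounds\<close>, auto)
  qed
  have tends: "g \<longlonglongrightarrow> ennreal (h x)"
  proof -
    have "((\<lambda>k. enn2real (g k)) \<longlonglongrightarrow> h x)"
    proof (rule LIMSEQ_I)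
      fix r :: real assume r: "0 < r"
      define e where "e = min (1 / 2) (r / (4 * (h x + 1)))"
      have e: "0 < e" "e < 1" "e \<le> 1 / 2" "2 * e * h x < r"
      proof -
        have hx: "0 < h x + 1"
          using h(1)[of x] by linarith
        then show "0 < e"
          using r by (simp add: e_def)
        show "e \<le> 1 / 2"
          by (simp only: e_def min.cobounded1)
        then show "e < 1"
          by linarith
        have "2 * e * h x \<le> 2 * (r / (4 * (h x + 1))) * h x"
          using h(1)[of x] by (intro mult_right_mono mult_left_mono) (auto simp: e_def)
        also have "\<dots> < r"
          using hx r h(1)[of x] by (simp add: field_simps add_pos_nonneg)
        finally show "2 * e * h x < r" .
      qed
      have "\<forall>\<^sub>F k in sequentially. norm (enn2real (g k) - h x) < r"
        using ev[OF e(1,2)]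
      proof eventually_elim
        case (elim k)
        then obtain m where m: "g k = ennreal m" "(1 - e) * m \<le> h x" "h x \<le> (1 + e) * m"
          by blast
        have "0 \<le> (1 + e) * m"
          using m(3) h(1)[of x] by linarith
        then have m0: "0 \<le> m"
          using e(1) by (simp add: zero_le_mult_iff)
        have "(1 / 2) * m \<le> (1 - e) * m"
          using m0 e(3) by (intro mult_right_mono) auto
        then have "m \<le> 2 * h x"
          using m(2) by linarith
        then have "e * m \<le> e * (2 * h x)"
          using e(1) by (intro mult_left_mono) auto
        then have "\<bar>m - h x\<bar> < r"
          using m(2,3) e(4) by (simp add: algebra_simps abs_less_iff)
        with m(1) m0 show ?case
          by simp
      qed
      then show "\<exists>no. \<forall>n\<ge>no. norm (enn2real (g n) - h x) < r"
        unfolding eventually_sequentially .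
    qed
    then have "(\<lambda>k. ennreal (enn2real (g k))) \<longlonglongrightarrow> ennreal (h x)"
      by (rule tendsto_ennrealI)
    moreover have "\<forall>\<^sub>F k in sequentially. ennreal (enn2real (g k)) = g k"
      using ev[of "1 / 2", simplified] by eventually_elim auto
    ultimately show ?thesis
      by (rule Lim_transform_eventually)
  qed
  obtain k0 m0 where "g k0 = ennreal m0"
    using eventually_happens'[OF _ ev[of "1 / 2"]] by auto
  then have k0: "g k0 < \<infinity>"
    by simp
  have "mean_hitting_time (P x) X R = (\<integral>\<^sup>+ \<omega>. (INF k. grid_time X R ((1 / 2) ^ k) \<omega>) \<partial>P x)"
    unfolding mean_hitting_time_def
    by (intro nn_integral_cong hitting_time_eq_INF_grid_time right_continuous_process)
  also have "\<dots> = (INF k. g k)"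
    unfolding g_def
  proof (rule nn_integral_monotone_convergence_INF_decseq)
    show "decseq (\<lambda>k. grid_time X R ((1 / 2) ^ k))"
      by (intro decseq_SucI le_funI decseq_SucD[OF decseq_grid_time])
    show "grid_time X R ((1 / 2) ^ k) \<in> borel_measurable (P x)" for k
      by (rule nn_integral_grid_time(2)) simp
    show "(\<integral>\<^sup>+ \<omega>. grid_time X R ((1 / 2) ^ k0) \<omega> \<partial>P x) < \<infinity>"
      using k0 by (simp add: g_def)
  qed
  also have "\<dots> = ennreal (h x)"
  proof (rule LIMSEQ_unique[OF LIMSEQ_INF tends])
    show "decseq g"
      unfolding g_def by (intro decseq_SucI nn_integral_mono decseq_SucD[OF decseq_grid_time])
  qed
  finally show ?thesis .
qed

end

section \<open>The characteristic polynomial as a forest sum\<close>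

lemma det_map_matrix:
  fixes A :: "'b::comm_ring_1 ^ 'n ^ 'n" and h :: "'b \<Rightarrow> 'c::comm_ring_1"
  assumes h: "h 0 = 0" "h 1 = 1" "\<And>a b. h (a + b) = h a + h b" "\<And>a b. h (a * b) = h a * h b"
  shows "det (map_matrix h A) = h (det A)"
proof -
  have neg: "h (- a) = - h a" for a
    using h(1) h(3)[of "- a" a] by (simp add: eq_neg_iff_add_eq_0)
  have sum: "h (sum g S) = (\<Sum>x\<in>S. h (g x))" for g :: "('n \<Rightarrow> 'n) \<Rightarrow> 'b" and S
    by (induction S rule: infinite_finite_induct) (simp_all add: h)
  have prod: "h (prod g S) = (\<Prod>x\<in>S. h (g x))" for g :: "'n \<Rightarrow> 'b" and S
    by (induction S rule: infinite_finite_induct) (simp_all add: h)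
  have sign: "h (of_int (sign p)) = of_int (sign p)" for p :: "'n \<Rightarrow> 'n"
    by (cases p rule: sign_cases) (simp_all add: h neg)
  show ?thesis
    by (simp add: det_def sum h(4) sign prod)
qed

lemma poly_charpoly: "poly (charpoly A) z = det (mat z - A)"
proof -
  have "poly (charpoly A) z = det (map_matrix (\<lambda>p. poly p z) (mat [:0, 1:] - map_matrix (\<lambda>c. [:c:]) A))"
    unfolding charpoly_def by (rule det_map_matrix[symmetric]) simp_all
  also have "map_matrix (\<lambda>p. poly p z) (mat [:0, 1:] - map_matrix (\<lambda>c. [:c:]) A) = mat z - A"
    by (simp add: vec_eq_iff mat_def)
  finally show ?thesis .
qed

definition fun_matrix :: "('a::finite \<Rightarrow> 'a) \<Rightarrow> real ^ 'a ^ 'a" where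
  "fun_matrix f = (\<chi> x. if f x = x then axis x 1 else axis x 1 - axis (f x) 1)"

lemma fun_matrix_apply: "(fun_matrix f *v v) $ x = (if f x = x then v $ x else v $ x - v $ f x)"
  by (simp add: fun_matrix_def matrix_vector_mult_def axis_def left_diff_distrib sum_subtractf mult_if_delta)

lemma det_fun_matrix_not_forest:
  assumes "\<not> forest_fun f"
  shows "det (fun_matrix f) = 0"
proof (rule ccontr)
  assume "det (fun_matrix f) \<noteq> 0"
  then obtain B where B: "B ** fun_matrix f = mat 1"
    using invertible_det_nz[of "fun_matrix f"] unfolding invertible_def by blast
  define v :: "real ^ 'a" where "v = (\<chi> x. of_bool (\<nexists>r. leads f x r))"
  have "(fun_matrix f *v v) $ x = 0" for x
  proof (cases "f x = x")
    case True
    then have "leads f x x"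
      by (rule leads_fixed)
    then have "v $ x = 0"
      unfolding v_def by auto
    with True show ?thesis
      by (simp add: fun_matrix_apply)
  next
    case False
    have "(\<exists>r. leads f (f x) r) \<longleftrightarrow> (\<exists>r. leads f x r)"
      using leads_apply leads_step by metis
    then have "v $ f x = v $ x"
      unfolding v_def by (simp only: vec_lambda_beta)
    with False show ?thesis
      by (simp add: fun_matrix_apply)
  qed
  then have "fun_matrix f *v v = 0"
    by (simp add: vec_eq_iff)
  then have "v = 0"
    using B by (metis matrix_vector_mul_assoc matrix_vector_mul_lid matrix_vector_mult_0_right)
  moreover obtain x where "\<nexists>r. leads f x r"
    using assms unfolding forest_fun_def by blast
  then have "v $ x = 1"
    unfolding v_def by simp
  ultimately show False
    by simp
qed

text \<open>
  A permutation contributing to the determinant maps every vertex to itself or to its successor, so it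
  does not increase the depth; as it preserves the total depth, it fixes every vertex.
\<close>

lemma det_fun_matrix_forest:
  fixes f :: "'a::finite \<Rightarrow> 'a"
  assumes "forest_fun f"
  shows "det (fun_matrix f) = 1"
proof -
  have zero: "(\<Prod>x\<in>UNIV. fun_matrix f $ x $ p x) = 0" if p: "p permutes UNIV" "p \<noteq> id" for p
  proof (rule ccontr)
    assume "(\<Prod>x\<in>UNIV. fun_matrix f $ x $ p x) \<noteq> 0"
    then have nz: "fun_matrix f $ x $ p x \<noteq> 0" for x
      by auto
    have move: "p x = x \<or> (f x \<noteq> x \<and> p x = f x)" for x
      using nz[of x] by (auto simp: fun_matrix_def axis_def split: if_splits)
    then have le: "depth f (p x) \<le> depth f x" for x
      using depth_apply[OF assms, of x] by (metis le_SucI order_refl)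
    obtain x where x: "p x \<noteq> x"
      using p(2) by (auto simp: fun_eq_iff)
    then have "depth f (p x) < depth f x"
      using move[of x] depth_apply[OF assms, of x] by auto
    then have "(\<Sum>x\<in>UNIV. depth f (p x)) < (\<Sum>x\<in>UNIV. depth f x)"
      using le by (intro sum_strict_mono_ex1) auto
    moreover have "(\<Sum>x\<in>UNIV. depth f (p x)) = (\<Sum>x\<in>UNIV. depth f x)"
      using sum.permute[OF p(1), of "depth f"] by (simp add: o_def)
    ultimately show False
      by simp
  qed
  have "det (fun_matrix f) =
      (\<Sum>p\<in>{p. p permutes UNIV}. of_int (sign p) * (\<Prod>x\<in>UNIV. fun_matrix f $ x $ p x))"
    by (simp add: det_def)
  also have "\<dots> = (\<Sum>p\<in>{id}. of_int (sign p) * (\<Prod>x\<in>UNIV. fun_matrix f $ x $ p x))"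
    by (rule sum.mono_neutral_right) (auto simp: zero permutes_id)
  also have "\<dots> = 1"
    by (auto simp: sign_id fun_matrix_def axis_def intro!: prod.neutral)
  finally show ?thesis .
qed

lemma det_resolvent:
  fixes w :: "'a::finite \<Rightarrow> 'a \<Rightarrow> real"
  shows "det (mat q - gen_matrix w) =
    (\<Sum>f\<in>{f. forest_fun f}. fun_weight w f * q ^ card (fixed_points f))"
proof -
  define c where "c x z = (if z = x then q else w x z)" for x z
  define b :: "'a \<Rightarrow> 'a \<Rightarrow> real ^ 'a" where
    "b x z = (if z = x then axis x 1 else axis x 1 - axis z 1)" for x z
  have row: "(\<Sum>z\<in>UNIV. c x z *s b x z) $ y = (mat q - gen_matrix w) $ x $ y" for x y
  proof -
    have "(\<Sum>z\<in>UNIV. c x z *s b x z) $ y =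
        (\<Sum>z\<in>UNIV. (if z = x then (if x = y then q else 0) else 0) -
          w x z * ((if z = y then 1 else 0) - (if x = y then 1 else 0)))"
      unfolding sum_component by (intro sum.cong refl) (auto simp: c_def b_def axis_def)
    also have "\<dots> = (mat q - gen_matrix w) $ x $ y"
      by (simp only: sum_subtractf) (simp add: mat_def gen_matrix_nth)
    finally show ?thesis .
  qed
  have "mat q - gen_matrix w = (\<chi> x. \<Sum>z\<in>UNIV. c x z *s b x z)"
    unfolding vec_eq_iff vec_lambda_beta row by simp
  then have "det (mat q - gen_matrix w) = (\<Sum>f\<in>UNIV. det (\<chi> x. c x (f x) *s b x (f x)))"
    by (simp add: det_linear_rows_sum)
  also have "\<dots> = (\<Sum>f\<in>UNIV. (\<Prod>x\<in>UNIV. c x (f x)) * det (fun_matrix f))"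
    unfolding det_rows_mul fun_matrix_def b_def ..
  also have "\<dots> = (\<Sum>f\<in>{f. forest_fun f}. \<Prod>x\<in>UNIV. c x (f x))"
    by (rule sum.mono_neutral_cong_right)
      (auto simp: det_fun_matrix_forest det_fun_matrix_not_forest)
  also have "\<dots> = (\<Sum>f\<in>{f. forest_fun f}. fun_weight w f * q ^ card (fixed_points f))"
  proof (rule sum.cong[OF refl])
    fix f :: "'a \<Rightarrow> 'a"
    have "(\<Prod>x\<in>UNIV. c x (f x)) = (\<Prod>x\<in>fixed_points f. c x (f x)) * (\<Prod>x\<in>- fixed_points f. c x (f x))"
      by (subst prod.union_disjoint[symmetric]) (auto intro: prod.cong)
    also have "(\<Prod>x\<in>fixed_points f. c x (f x)) = (\<Prod>x\<in>fixed_points f. q)"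
      by (intro prod.cong) (auto simp: fixed_points_def c_def)
    also have "(\<Prod>x\<in>- fixed_points f. c x (f x)) = fun_weight w f"
      unfolding fun_weight_def by (intro prod.cong) (auto simp: fixed_points_def c_def)
    finally show "(\<Prod>x\<in>UNIV. c x (f x)) = fun_weight w f * q ^ card (fixed_points f)"
      by simp
  qed
  finally show ?thesis .
qed

definition forest_coeff :: "('a::finite \<Rightarrow> 'a \<Rightarrow> real) \<Rightarrow> nat \<Rightarrow> real" where
  "forest_coeff w k = (\<Sum>f\<in>{f. forest_fun f \<and> card (fixed_points f) = k}. fun_weight w f)"

lemma charpoly_gen_matrix:
  "charpoly (gen_matrix w) = (\<Sum>f\<in>{f. forest_fun f}. monom (fun_weight w f) (card (fixed_points f)))"
  unfolding poly_eq_poly_eq_iff[symmetric]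
  by (rule ext) (simp add: poly_charpoly det_resolvent poly_sum poly_monom)

lemma coeff_charpoly_gen_matrix: "coeff (charpoly (gen_matrix w)) k = forest_coeff w k"
proof -
  have "coeff (charpoly (gen_matrix w)) k =
      (\<Sum>f\<in>{f. forest_fun f}. if card (fixed_points f) = k then fun_weight w f else 0)"
    unfolding charpoly_gen_matrix by (simp add: coeff_sum)
  also have "\<dots> = forest_coeff w k"
    unfolding forest_coeff_def by (rule sum.mono_neutral_cong_right) auto
  finally show ?thesis .
qed

lemma forest_coeff_0: "forest_coeff w 0 = 0"
  using fixed_points_nonempty by (auto simp: forest_coeff_def intro!: sum.neutral)

lemma forest_coeff_gt:
  assumes "CARD('a) < k"
  shows "forest_coeff (w :: 'a::finite \<Rightarrow> _) k = 0"
proof -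
  have "card (fixed_points f) \<noteq> k" for f :: "'a \<Rightarrow> 'a"
    using card_mono[of UNIV "fixed_points f"] assms by auto
  then show ?thesis
    unfolding forest_coeff_def by (intro sum.neutral) auto
qed

lemma forest_coeff_CARD: "forest_coeff (w :: 'a::finite \<Rightarrow> _) CARD('a) = 1"
proof -
  have fx: "fixed_points f = UNIV \<longleftrightarrow> f = id" for f :: "'a \<Rightarrow> 'a"
    unfolding fixed_points_def by (simp add: set_eq_iff fun_eq_iff)
  have "leads id x x" for x :: 'a
    by (rule leads_fixed) simp
  then have "forest_fun (id :: 'a \<Rightarrow> 'a)"
    unfolding forest_fun_def by blast
  moreover have "card (fixed_points (id :: 'a \<Rightarrow> 'a)) = CARD('a)"
    using fx[of id] by simp
  ultimately have "{f :: 'a \<Rightarrow> 'a. forest_fun f \<and> card (fixed_points f) = CARD('a)} = {id}"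
    using fx card_eq_UNIV_imp_eq_UNIV[OF finite_class.finite_UNIV] by auto
  then show ?thesis
    using fx[of id] by (simp add: forest_coeff_def fun_weight_def)
qed

lemma charpoly_gen_matrix_expansion:
  fixes w :: "'a::finite \<Rightarrow> 'a \<Rightarrow> real"
  shows "charpoly (gen_matrix w) =
    (\<Sum>k=1..CARD('a). monom (coeff (charpoly (gen_matrix w)) k) k)"
proof (rule poly_eqI)
  fix k
  have "k \<notin> {1..CARD('a)} \<Longrightarrow> coeff (charpoly (gen_matrix w)) k = 0"
    using forest_coeff_0[of w] forest_coeff_gt[of k w]
    by (cases "k = 0") (auto simp: coeff_charpoly_gen_matrix)
  then show "coeff (charpoly (gen_matrix w)) k =
      coeff (\<Sum>k=1..CARD('a). monom (coeff (charpoly (gen_matrix w)) k) k) k"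
    by (auto simp: coeff_sum)
qed

lemma eigenvalue_enum_prod:
  fixes A :: "complex ^ 'n ^ 'n"
  assumes "eigenvalue_enum A lam" "charpoly A \<noteq> 0"
  shows "charpoly A = smult (lead_coeff (charpoly A)) (\<Prod>i<CARD('n). [:- lam i, 1:])"
proof -
  define p where "p = charpoly A"
  have ord: "card {i \<in> {..<CARD('n)}. lam i = z} = order z p" for z
    using assms(1) by (simp add: eigenvalue_enum_def p_def)
  have roots: "lam ` {..<CARD('n)} = {z. poly p z = 0}"
  proof -
    have "z \<in> lam ` {..<CARD('n)} \<longleftrightarrow> card {i \<in> {..<CARD('n)}. lam i = z} \<noteq> 0" for z
      by auto
    then have "z \<in> lam ` {..<CARD('n)} \<longleftrightarrow> z \<in> {z. poly p z = 0}" for z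
      unfolding ord using assms(2) order_root[of p z] by (auto simp only: mem_Collect_eq p_def)
    then show ?thesis
      by (rule set_eqI)
  qed
  have "(\<Prod>i<CARD('n). [:- lam i, 1:]) =
      (\<Prod>z\<in>lam ` {..<CARD('n)}. \<Prod>i\<in>{i \<in> {..<CARD('n)}. lam i = z}. [:- lam i, 1:])"
    by (rule prod.image_gen) simp
  also have "\<dots> = (\<Prod>z\<in>lam ` {..<CARD('n)}. [:- z, 1:] ^ order z p)"
    using ord by (intro prod.cong refl) simp
  finally have "smult (lead_coeff p) (\<Prod>i<CARD('n). [:- lam i, 1:]) = p"
    unfolding roots by (simp only: complex_poly_decompose)
  then show ?thesis
    unfolding p_def by (rule sym)
qed

lemma det_uminus:
  fixes A :: "'b::comm_ring_1 ^ 'n ^ 'n"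
  shows "det (- A) = (- 1) ^ CARD('n) * det A"
proof -
  have "- A = (\<chi> i. (- 1) *s (A $ i))"
    by (simp add: vec_eq_iff)
  then have "det (- A) = (\<Prod>i\<in>(UNIV :: 'n set). - 1) * det (\<chi> i. A $ i)"
    by (simp only: det_rows_mul)
  then show ?thesis
    by simp
qed

lemma prod_eigenvalues:
  fixes w :: "'a::finite \<Rightarrow> 'a \<Rightarrow> real"
  assumes lam: "eigenvalue_enum (map_matrix complex_of_real (- gen_matrix w)) lam" "lam 0 = 0"
  assumes q: "poly (charpoly (gen_matrix w)) q \<noteq> 0"
  shows "(\<Prod>i=1..CARD('a) - 1. lam i / (of_real q + lam i)) =
    of_real (q * forest_coeff w 1 / poly (charpoly (gen_matrix w)) q)"
proof -
  define A where "A = map_matrix complex_of_real (- gen_matrix w)"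
  define p where "p = map_poly complex_of_real (charpoly (gen_matrix w))"
  define r where "r = (\<Prod>i\<in>{1..CARD('a) - 1}. [:lam i, 1:])"
  have p_eval: "poly p (of_real t) = of_real (poly (charpoly (gen_matrix w)) t)" for t
  proof -
    have "poly (map_poly complex_of_real u) (of_real t) = of_real (poly u t)" for u
      by (induction u) (simp_all add: map_poly_pCons)
    then show ?thesis
      by (simp add: p_def)
  qed
  have A_eval: "poly (charpoly A) (- of_real t) = (- 1) ^ CARD('a) * poly p (of_real t)" for t
  proof -
    have "mat (- of_real t) - A = - map_matrix complex_of_real (mat t - gen_matrix w)"
      by (simp add: A_def vec_eq_iff mat_def)
    then show ?thesis
      unfolding poly_charpoly p_eval by (simp add: det_uminus det_map_matrix)
  qed
  have "poly (charpoly A) (- of_real q) \<noteq> 0"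
    unfolding A_eval p_eval using q by simp
  then have A0: "charpoly A \<noteq> 0"
    by auto
  define c where "c = (- 1) ^ CARD('a) * lead_coeff (charpoly A) * (- 1) ^ CARD('a)"
  have set_eq: "{..<CARD('a)} = insert 0 {1..CARD('a) - 1}"
    using zero_less_card_finite[where 'a = 'a] by auto
  have factor: "poly p (of_real t) = poly (smult c ([:0, 1:] * r)) (of_real t)" for t
  proof -
    have "poly (charpoly A) (- of_real t) =
        lead_coeff (charpoly A) * poly (\<Prod>i<CARD('a). [:- lam i, 1:]) (- of_real t)"
      using arg_cong[OF eigenvalue_enum_prod[OF lam(1)[folded A_def] A0],
          of "\<lambda>p. poly p (- of_real t)"] by (simp only: poly_smult)
    also have "poly (\<Prod>i<CARD('a). [:- lam i, 1:]) (- of_real t) = (\<Prod>i<CARD('a). (- 1) * (of_real t + lam i))"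
      unfolding poly_prod by (intro prod.cong) auto
    also have "(\<Prod>i<CARD('a). (- 1) * (of_real t + lam i)) = (- 1) ^ CARD('a) * (\<Prod>i<CARD('a). of_real t + lam i)"
      by (simp only: prod.distrib prod_constant card_lessThan)
    finally have "(- 1) ^ CARD('a) * ((- 1) ^ CARD('a) * poly p (of_real t)) =
        c * (\<Prod>i<CARD('a). of_real t + lam i)"
      unfolding A_eval by (simp add: c_def)
    then have "poly p (of_real t) = c * (\<Prod>i<CARD('a). of_real t + lam i)"
      by (simp add: mult.assoc[symmetric] power_mult_distrib[symmetric])
    then show ?thesis
      unfolding set_eq by (simp add: lam(2) r_def poly_prod add.commute mult_ac)
  qed
  have "p = smult c ([:0, 1:] * r)"
  proof (rule ccontr)
    assume "p \<noteq> smult c ([:0, 1:] * r)"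
    then have "finite {z. poly (p - smult c ([:0, 1:] * r)) z = 0}"
      by (intro poly_roots_finite) simp
    moreover have "range complex_of_real \<subseteq> {z. poly (p - smult c ([:0, 1:] * r)) z = 0}"
      using factor by auto
    ultimately have "finite (range complex_of_real)"
      by (rule finite_subset[rotated])
    then show False
      using finite_imageD[OF _ inj_of_real] infinite_UNIV_char_0 by blast
  qed
  then have "coeff p 1 = c * coeff r 0"
    by simp
  also have "coeff r 0 = (\<Prod>i=1..CARD('a) - 1. lam i)"
    unfolding poly_0_coeff_0[symmetric] r_def by (simp add: poly_prod)
  finally have c1: "of_real (forest_coeff w 1) = c * (\<Prod>i=1..CARD('a) - 1. lam i)"
    unfolding p_def by (simp add: coeff_map_poly coeff_charpoly_gen_matrix)
  have pq: "of_real (poly (charpoly (gen_matrix w)) q) =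
      c * of_real q * (\<Prod>i=1..CARD('a) - 1. of_real q + lam i)"
    unfolding p_eval[symmetric] factor by (simp add: r_def poly_prod add.commute mult_ac)
  have "of_real (poly (charpoly (gen_matrix w)) q) \<noteq> (0 :: complex)"
    using q by simp
  then have "c \<noteq> 0" "q \<noteq> 0"
    unfolding pq by auto
  then have "(\<Prod>i=1..CARD('a) - 1. lam i) / (\<Prod>i=1..CARD('a) - 1. of_real q + lam i) =
      of_real (q * forest_coeff w 1) / of_real (poly (charpoly (gen_matrix w)) q)"
    unfolding pq of_real_mult c1 by simp
  then show ?thesis
    by (simp add: prod_dividef)
qed

section \<open>The law of the random forest\<close>

definition killing_weight :: "('a::finite \<Rightarrow> ennreal) \<Rightarrow> 'a set \<Rightarrow> real" where
  "killing_weight Q R = (\<Prod>x\<in>R - {x. Q x = \<infinity>}. enn2real (Q x)) * (if {x. Q x = \<infinity>} \<subseteq> R then 1 else 0)"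

lemma killing_weight_nonneg: "0 \<le> killing_weight Q R"
  unfolding killing_weight_def by (intro mult_nonneg_nonneg prod_nonneg) auto

lemma killing_weight_remove:
  assumes "Q y \<noteq> \<infinity>" "y \<in> R"
  shows "killing_weight Q R = enn2real (Q y) * killing_weight Q (R - {y})"
proof -
  have "R - {x. Q x = \<infinity>} = insert y (R - {y} - {x. Q x = \<infinity>})"
    using assms by auto
  moreover have "{x. Q x = \<infinity>} \<subseteq> R \<longleftrightarrow> {x. Q x = \<infinity>} \<subseteq> R - {y}"
    using assms by auto
  ultimately show ?thesis
    by (simp add: killing_weight_def)
qed

lemma killing_weight_infinite: "Q y = \<infinity> \<Longrightarrow> y \<notin> R \<Longrightarrow> killing_weight Q R = 0"
  by (auto simp: killing_weight_def)

lemma killing_weight_upd: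
  assumes "Q y \<noteq> \<infinity>" "c \<noteq> \<infinity>" "y \<notin> R"
  shows "killing_weight (Q(y := c)) R = killing_weight Q R"
proof -
  have "{x. (Q(y := c)) x = \<infinity>} = {x. Q x = \<infinity>}"
    using assms by auto
  moreover have "(\<Prod>x\<in>R - S. enn2real ((Q(y := c)) x)) = (\<Prod>x\<in>R - S. enn2real (Q x))" for S
    using assms(3) by (intro prod.cong) auto
  ultimately show ?thesis
    by (simp only: killing_weight_def)
qed

lemma killing_weight_const:
  assumes "0 < q"
  shows "killing_weight (\<lambda>_. ennreal q) R = q ^ card R"
  using assms by (simp add: killing_weight_def)

lemma forest_weight_edge_set:
  "forest_weight w Q (edge_set f) = fun_weight w f * killing_weight Q (fixed_points f)"
proof -
  have "edge_set f = (\<lambda>x. (x, f x)) ` (- fixed_points f)"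
    by (auto simp: edge_set_def fixed_points_def)
  then have "(\<Prod>(x, y)\<in>edge_set f. w x y) = fun_weight w f"
    by (simp add: prod.reindex inj_on_def fun_weight_def)
  then show ?thesis
    by (simp add: forest_weight_def killing_weight_def roots_edge_set mult.assoc)
qed

context
  fixes w :: "'a::finite \<Rightarrow> 'a \<Rightarrow> real"
  assumes rates: "\<And>x y. 0 \<le> w x y" and irred: "irreducible_rates w"
begin

lemma sum_forests:
  "(\<Sum>\<phi>\<in>forests w. forest_weight w Q \<phi> * F \<phi>) =
    (\<Sum>f\<in>{f. forest_fun f}. fun_weight w f * killing_weight Q (fixed_points f) * F (edge_set f))"
proof -
  have "forests w = edge_set ` {f. forest_fun f \<and> edge_set f \<subseteq> edges w}"
    by (auto simp: forests_def spanning_rooted_forests_eq)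
  moreover have "inj_on edge_set {f :: 'a \<Rightarrow> 'a. forest_fun f \<and> edge_set f \<subseteq> edges w}"
    using inj_edge_set by (rule inj_on_subset) simp
  ultimately have "(\<Sum>\<phi>\<in>forests w. forest_weight w Q \<phi> * F \<phi>) =
      (\<Sum>f\<in>{f. forest_fun f \<and> edge_set f \<subseteq> edges w}.
        fun_weight w f * killing_weight Q (fixed_points f) * F (edge_set f))"
    by (simp add: sum.reindex forest_weight_edge_set)
  also have "\<dots> = (\<Sum>f\<in>{f. forest_fun f}.
        fun_weight w f * killing_weight Q (fixed_points f) * F (edge_set f))"
  proof (rule sum.mono_neutral_left)
    have "fun_weight w f = 0" if nonedge: "\<not> edge_set f \<subseteq> edges w" for f
    proof -
      obtain x where "f x \<noteq> x" "\<not> 0 < w x (f x)"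
        using nonedge unfolding edge_set_def edges_def by blast
      then have "x \<in> - fixed_points f" "w x (f x) = 0"
        using rates[of x "f x"] by (auto simp: fixed_points_def)
      then show ?thesis
        unfolding fun_weight_def by (intro prod_zero) auto
    qed
    then show "\<forall>f\<in>{f. forest_fun f} - {f. forest_fun f \<and> edge_set f \<subseteq> edges w}.
        fun_weight w f * killing_weight Q (fixed_points f) * F (edge_set f) = 0"
      by auto
  qed auto
  finally show ?thesis .
qed

lemma forest_weight_nonneg: "\<phi> \<in> forests w \<Longrightarrow> 0 \<le> forest_weight w Q \<phi>"
  by (auto simp: forests_def spanning_rooted_forests_eq forest_weight_edge_set
      intro!: mult_nonneg_nonneg fun_weight_nonneg killing_weight_nonneg rates)

lemma partition_function_eq:
  "partition_function w Q =
    (\<Sum>f\<in>{f. forest_fun f}. fun_weight w f * killing_weight Q (fixed_points f))"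
  using sum_forests[of Q "\<lambda>_. 1"] by (simp add: partition_function_def)

lemma partition_function_pos:
  assumes "\<exists>x. Q x > 0"
  shows "0 < partition_function w Q"
proof -
  obtain x where x: "Q x > 0"
    using assms by blast
  define R where "R = (if {x. Q x = \<infinity>} = {} then {x} else {x. Q x = \<infinity>})"
  have "R \<noteq> {}"
    by (simp add: R_def)
  have "0 < killing_weight Q R"
  proof (cases "{x. Q x = \<infinity>} = {}")
    case True
    then have "Q x < top"
      by (auto simp: less_top)
    with x have "0 < enn2real (Q x)"
      by (simp add: enn2real_positive_iff)
    with True show ?thesis
      by (simp add: R_def killing_weight_def)
  next
    case False
    then have "R = {x. Q x = \<infinity>}"
      unfolding R_def by (rule if_not_P)
    then show ?thesis
      by (simp add: killing_weight_def)
  qed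
  moreover have "0 < rooted_weight w R"
    using rooted_weight_pos[of w R] rates irred \<open>R \<noteq> {}\<close> by blast
  ultimately have "0 < rooted_weight w R * killing_weight Q R"
    by simp
  also have "\<dots> = (\<Sum>f\<in>forests_rooted R. fun_weight w f * killing_weight Q (fixed_points f))"
    unfolding rooted_weight_def sum_distrib_right
    by (intro sum.cong) (auto simp: forests_rooted_def)
  also have "\<dots> \<le> partition_function w Q"
    unfolding partition_function_eq
    by (intro sum_mono2 mult_nonneg_nonneg fun_weight_nonneg killing_weight_nonneg rates)
      (auto simp: forests_rooted_def)
  finally show ?thesis .
qed

lemma measure_forest_law:
  assumes "\<exists>x. Q x > 0"
  shows "\<P>(\<phi> in forest_law w Q. A \<phi>) =
    (\<Sum>f\<in>{f. forest_fun f}. fun_weight w f * killing_weight Q (fixed_points f) * of_bool (A (edge_set f))) /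
      partition_function w Q"
proof -
  have Z: "0 < partition_function w Q"
    by (rule partition_function_pos[OF assms])
  have "\<P>(\<phi> in forest_law w Q. A \<phi>) =
      measure (point_measure (forests w) (\<lambda>\<phi>. ennreal (forest_weight w Q \<phi> / partition_function w Q)))
        {\<phi> \<in> forests w. A \<phi>}"
    by (simp add: forest_law_def space_point_measure)
  also have "\<dots> = (\<Sum>\<phi>\<in>{\<phi> \<in> forests w. A \<phi>}. forest_weight w Q \<phi> / partition_function w Q)"
    using Z forest_weight_nonneg by (subst measure_point_measure_finite_if) auto
  also have "\<dots> = (\<Sum>\<phi>\<in>forests w. forest_weight w Q \<phi> * of_bool (A \<phi>)) / partition_function w Q"
    unfolding sum_divide_distrib by (rule sum.mono_neutral_cong_left) auto
  finally show ?thesis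
    unfolding sum_forests .
qed

lemma nn_integral_forest_law:
  assumes "\<exists>x. Q x > 0" "\<And>f. forest_fun f \<Longrightarrow> g (edge_set f) = ennreal (r (edge_set f))"
    and "\<And>\<phi>. 0 \<le> r \<phi>"
  shows "(\<integral>\<^sup>+ \<phi>. g \<phi> \<partial>forest_law w Q) = ennreal (
    (\<Sum>f\<in>{f. forest_fun f}. fun_weight w f * killing_weight Q (fixed_points f) * r (edge_set f)) /
      partition_function w Q)"
proof -
  have Z: "0 < partition_function w Q"
    by (rule partition_function_pos[OF assms(1)])
  have g: "g \<phi> = ennreal (r \<phi>)" if "\<phi> \<in> forests w" for \<phi>
    using that assms(2) by (auto simp: forests_def spanning_rooted_forests_eq)
  have "(\<integral>\<^sup>+ \<phi>. g \<phi> \<partial>forest_law w Q) =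
      (\<Sum>\<phi>\<in>forests w. ennreal (forest_weight w Q \<phi> / partition_function w Q) * g \<phi>)"
    unfolding forest_law_def by (rule nn_integral_point_measure_finite) simp
  also have "\<dots> = (\<Sum>\<phi>\<in>forests w. ennreal (forest_weight w Q \<phi> / partition_function w Q * r \<phi>))"
  proof (rule sum.cong[OF refl])
    fix \<phi> assume \<phi>: "\<phi> \<in> forests w"
    have "0 \<le> forest_weight w Q \<phi> / partition_function w Q"
      using Z forest_weight_nonneg[OF \<phi>] by simp
    then show "ennreal (forest_weight w Q \<phi> / partition_function w Q) * g \<phi> =
        ennreal (forest_weight w Q \<phi> / partition_function w Q * r \<phi>)"
      unfolding g[OF \<phi>] by (rule ennreal_mult[symmetric, OF _ assms(3)])
  qed
  also have "\<dots> = ennreal (\<Sum>\<phi>\<in>forests w. forest_weight w Q \<phi> / partition_function w Q * r \<phi>)"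
    using Z forest_weight_nonneg assms(3) by (intro sum_ennreal) (auto intro!: mult_nonneg_nonneg)
  also have "(\<Sum>\<phi>\<in>forests w. forest_weight w Q \<phi> / partition_function w Q * r \<phi>) =
      (\<Sum>\<phi>\<in>forests w. forest_weight w Q \<phi> * r \<phi>) / partition_function w Q"
    unfolding sum_divide_distrib by (intro sum.cong) auto
  finally show ?thesis
    unfolding sum_forests .
qed

section \<open>Averaging the hitting times over the forests\<close>

definition routed_sum :: "('a set \<Rightarrow> real) \<Rightarrow> 'a \<Rightarrow> 'a \<Rightarrow> real" where
  "routed_sum c x y = (\<Sum>f\<in>{f. forest_fun f \<and> root_of f x = y \<and> fixed_points f \<noteq> {y}}.
     fun_weight w f * c (fixed_points f - {y}))"

text \<open>
  In the forest formula for the hitting time of the roots of \<open>f\<close>, the denominator cancels after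
  summation over all forests with these roots, leaving forests with one additional root \<open>y\<close>, whose
  tree contains \<open>x\<close>.
\<close>

lemma sum_forest_hitting:
  "(\<Sum>f\<in>{f. forest_fun f}. fun_weight w f * c (fixed_points f) * forest_hitting w (fixed_points f) x) =
    (\<Sum>y\<in>UNIV. routed_sum c x y)"
proof -
  have "(\<Sum>f\<in>{f. forest_fun f}. fun_weight w f * c (fixed_points f) * forest_hitting w (fixed_points f) x) =
      (\<Sum>R\<in>- {{}}. \<Sum>f\<in>{f \<in> {f. forest_fun f}. fixed_points f = R}.
        fun_weight w f * c (fixed_points f) * forest_hitting w (fixed_points f) x)"
    using fixed_points_nonempty by (intro sum.group[symmetric]) auto
  also have "\<dots> = (\<Sum>R\<in>- {{}}. \<Sum>y\<in>UNIV. if y \<notin> R then c R * routed_weight w x y (insert y R) else 0)"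
  proof (rule sum.cong[OF refl])
    fix R :: "'a set" assume "R \<in> - {{}}"
    then have R: "rooted_weight w R \<noteq> 0"
      using rooted_weight_pos[of w R] rates irred by force
    have "(\<Sum>f\<in>{f \<in> {f. forest_fun f}. fixed_points f = R}.
        fun_weight w f * c (fixed_points f) * forest_hitting w (fixed_points f) x) =
        c R * (rooted_weight w R * forest_hitting w R x)"
      unfolding rooted_weight_def forests_rooted_def sum_distrib_left sum_distrib_right
      by (intro sum.cong) auto
    also have "\<dots> = c R * (\<Sum>y\<in>- R. routed_weight w x y (insert y R))"
      using R by (simp add: forest_hitting_def)
    also have "\<dots> = (\<Sum>y\<in>UNIV. if y \<notin> R then c R * routed_weight w x y (insert y R) else 0)"
      unfolding sum_distrib_left by (rule sum.mono_neutral_cong_left) auto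
    finally show "(\<Sum>f\<in>{f \<in> {f. forest_fun f}. fixed_points f = R}.
        fun_weight w f * c (fixed_points f) * forest_hitting w (fixed_points f) x) =
      (\<Sum>y\<in>UNIV. if y \<notin> R then c R * routed_weight w x y (insert y R) else 0)" .
  qed
  also have "\<dots> = (\<Sum>y\<in>UNIV. \<Sum>R\<in>- {{}}. if y \<notin> R then c R * routed_weight w x y (insert y R) else 0)"
    by (rule sum.swap)
  also have "\<dots> = (\<Sum>y\<in>UNIV. routed_sum c x y)"
  proof (rule sum.cong[OF refl])
    fix y :: 'a
    have "(\<Sum>R\<in>- {{}}. if y \<notin> R then c R * routed_weight w x y (insert y R) else 0) =
        (\<Sum>R\<in>{R. R \<noteq> {} \<and> y \<notin> R}. c R * routed_weight w x y (insert y R))"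
      by (rule sum.mono_neutral_cong_right) auto
    also have "\<dots> = (\<Sum>R\<in>{R. y \<in> R \<and> R \<noteq> {y}}. c (R - {y}) * routed_weight w x y R)"
      by (rule sum.reindex_bij_witness[where i = "\<lambda>R. R - {y}" and j = "insert y"]) auto
    also have "\<dots> = (\<Sum>R\<in>{R. y \<in> R \<and> R \<noteq> {y}}.
        \<Sum>f\<in>{f \<in> {f. forest_fun f \<and> root_of f x = y \<and> fixed_points f \<noteq> {y}}. fixed_points f = R}.
          fun_weight w f * c (fixed_points f - {y}))"
    proof (rule sum.cong[OF refl])
      fix R assume R: "R \<in> {R. y \<in> R \<and> R \<noteq> {y}}"
      show "c (R - {y}) * routed_weight w x y R =
          (\<Sum>f\<in>{f \<in> {f. forest_fun f \<and> root_of f x = y \<and> fixed_points f \<noteq> {y}}. fixed_points f = R}.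
            fun_weight w f * c (fixed_points f - {y}))"
        unfolding routed_weight_def forests_rooted_def sum_distrib_left
        by (rule sum.mono_neutral_cong_right) (use R in auto)
    qed
    also have "\<dots> = routed_sum c x y"
      unfolding routed_sum_def by (intro sum.group) (auto simp: root_of_in_fixed_points)
    finally show "(\<Sum>R\<in>- {{}}. if y \<notin> R then c R * routed_weight w x y (insert y R) else 0) =
        routed_sum c x y" .
  qed
  finally show ?thesis .
qed

lemma sum_routed_sum:
  "(\<Sum>y\<in>UNIV. routed_sum c x y) =
    (\<Sum>f\<in>{f. forest_fun f \<and> card (fixed_points f) \<noteq> 1}.
      fun_weight w f * c (fixed_points f - {root_of f x}))"
proof -
  have single: "fixed_points f = {root_of f x} \<longleftrightarrow> card (fixed_points f) = 1" if "forest_fun f" for f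
    using root_of_in_fixed_points[OF that, of x] by (auto simp: card_1_singleton_iff)
  have "(\<Sum>f\<in>{f. forest_fun f \<and> card (fixed_points f) \<noteq> 1}.
      fun_weight w f * c (fixed_points f - {root_of f x})) =
      (\<Sum>y\<in>UNIV. \<Sum>f\<in>{f \<in> {f. forest_fun f \<and> card (fixed_points f) \<noteq> 1}. root_of f x = y}.
        fun_weight w f * c (fixed_points f - {root_of f x}))"
    by (rule sum.group[symmetric]) auto
  also have "\<dots> = (\<Sum>y\<in>UNIV. routed_sum c x y)"
    unfolding routed_sum_def using single by (intro sum.cong refl) auto
  finally show ?thesis
    by (rule sym)
qed

lemma prob_root_diff:
  assumes "\<exists>x. Q x > 0" "Q y \<noteq> \<infinity>"
  shows "\<P>(\<phi> in forest_law w Q. roots \<phi> \<inter> tree_of \<phi> x = {y}) - \<P>(\<phi> in forest_law w Q. roots \<phi> = {y}) =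
    enn2real (Q y) * routed_sum (killing_weight Q) x y / partition_function w Q"
proof -
  have "(\<Sum>f\<in>{f. forest_fun f}. fun_weight w f * killing_weight Q (fixed_points f) *
        of_bool (roots (edge_set f) \<inter> tree_of (edge_set f) x = {y})) -
      (\<Sum>f\<in>{f. forest_fun f}. fun_weight w f * killing_weight Q (fixed_points f) *
        of_bool (roots (edge_set f) = {y})) =
      enn2real (Q y) * routed_sum (killing_weight Q) x y"
    unfolding sum_subtractf[symmetric] routed_sum_def sum_distrib_left
  proof (rule sum.mono_neutral_cong_right)
    have *: "fun_weight w f * killing_weight Q (fixed_points f) *
          of_bool (roots (edge_set f) \<inter> tree_of (edge_set f) x = {y}) -
        fun_weight w f * killing_weight Q (fixed_points f) * of_bool (roots (edge_set f) = {y}) =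
        (if root_of f x = y \<and> fixed_points f \<noteq> {y}
         then enn2real (Q y) * (fun_weight w f * killing_weight Q (fixed_points f - {y})) else 0)"
      if f: "forest_fun f" for f
    proof (cases "root_of f x = y")
      case True
      then have "y \<in> fixed_points f"
        using root_of_in_fixed_points[OF f, of x] by simp
      then have "killing_weight Q (fixed_points f) = enn2real (Q y) * killing_weight Q (fixed_points f - {y})"
        by (rule killing_weight_remove[of Q y, OF assms(2)])
      with True show ?thesis
        unfolding roots_Int_tree_of[OF f] unfolding roots_edge_set by simp
    next
      case False
      then have "fixed_points f \<noteq> {y}"
        using root_of_in_fixed_points[OF f, of x] by auto
      with False show ?thesis
        unfolding roots_Int_tree_of[OF f] unfolding roots_edge_set by simp
    qed
    show "\<forall>f\<in>{f. forest_fun f} - {f. forest_fun f \<and> root_of f x = y \<and> fixed_points f \<noteq> {y}}.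
        fun_weight w f * killing_weight Q (fixed_points f) *
          of_bool (roots (edge_set f) \<inter> tree_of (edge_set f) x = {y}) -
        fun_weight w f * killing_weight Q (fixed_points f) * of_bool (roots (edge_set f) = {y}) = 0"
    proof
      fix f assume "f \<in> {f. forest_fun f} - {f. forest_fun f \<and> root_of f x = y \<and> fixed_points f \<noteq> {y}}"
      then have f: "forest_fun f" and neg: "\<not> (root_of f x = y \<and> fixed_points f \<noteq> {y})"
        by auto
      show "fun_weight w f * killing_weight Q (fixed_points f) *
            of_bool (roots (edge_set f) \<inter> tree_of (edge_set f) x = {y}) -
          fun_weight w f * killing_weight Q (fixed_points f) * of_bool (roots (edge_set f) = {y}) = 0"
        unfolding *[OF f] by (rule if_not_P[OF neg])
    qed
    show "fun_weight w f * killing_weight Q (fixed_points f) *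
          of_bool (roots (edge_set f) \<inter> tree_of (edge_set f) x = {y}) -
        fun_weight w f * killing_weight Q (fixed_points f) * of_bool (roots (edge_set f) = {y}) =
        enn2real (Q y) * (fun_weight w f * killing_weight Q (fixed_points f - {y}))"
      if "f \<in> {f. forest_fun f \<and> root_of f x = y \<and> fixed_points f \<noteq> {y}}" for f
    proof -
      have f: "forest_fun f" and pos: "root_of f x = y \<and> fixed_points f \<noteq> {y}"
        using that by auto
      show ?thesis
        unfolding *[OF f] by (rule if_P[OF pos])
    qed
  qed auto
  then show ?thesis
    unfolding measure_forest_law[OF assms(1)] diff_divide_distrib[symmetric] by simp
qed

lemma routed_sum_cong: "(\<And>R. y \<notin> R \<Longrightarrow> c R = d R) \<Longrightarrow> routed_sum c x y = routed_sum d x y"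
  unfolding routed_sum_def by (intro sum.cong refl) simp

lemma zero_rate_term_eq:
  assumes "\<exists>x. Q x > 0" "Q y = 0"
  shows "zero_rate_term w Q x y = routed_sum (killing_weight Q) x y / partition_function w Q"
proof -
  have kw: "((\<lambda>e. killing_weight (Q(y := ennreal e)) R) \<longlongrightarrow> killing_weight Q R) (at_right 0)" for R
  proof (cases "y \<in> R")
    case True
    have "killing_weight Q R = 0"
      using killing_weight_remove[of Q y R] True assms(2) by simp
    moreover have "((\<lambda>e. e * killing_weight Q (R - {y})) \<longlongrightarrow> 0 * killing_weight Q (R - {y})) (at_right 0)"
      by (intro tendsto_intros)
    moreover have "\<forall>\<^sub>F e in at_right 0.
        e * killing_weight Q (R - {y}) = killing_weight (Q(y := ennreal e)) R"
      using eventually_at_right_less[of 0]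
    proof eventually_elim
      case (elim e)
      have "killing_weight (Q(y := ennreal e)) R = e * killing_weight (Q(y := ennreal e)) (R - {y})"
        using killing_weight_remove[of "Q(y := ennreal e)" y R] True elim by simp
      then show ?case
        using killing_weight_upd[of Q y "ennreal e" "R - {y}"] assms(2) by simp
    qed
    ultimately show ?thesis
      using Lim_transform_eventually by fastforce
  next
    case False
    then show ?thesis
      using killing_weight_upd[of Q y _ R] assms(2) by simp
  qed
  have Z0: "partition_function w Q \<noteq> 0"
    using partition_function_pos[OF assms(1)] by simp
  have "((\<lambda>e. routed_sum (killing_weight Q) x y / partition_function w (Q(y := ennreal e))) \<longlongrightarrow>
      routed_sum (killing_weight Q) x y / partition_function w Q) (at_right 0)"
    using Z0 unfolding partition_function_eq by (intro tendsto_intros kw)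
  moreover have "\<forall>\<^sub>F e in at_right 0. routed_sum (killing_weight Q) x y / partition_function w (Q(y := ennreal e)) =
      1 / e * (\<P>(\<phi> in forest_law w (Q(y := ennreal e)). roots \<phi> \<inter> tree_of \<phi> x = {y}) -
        \<P>(\<phi> in forest_law w (Q(y := ennreal e)). roots \<phi> = {y}))"
    using eventually_at_right_less[of 0]
  proof eventually_elim
    case (elim e)
    have pos: "\<exists>x. (Q(y := ennreal e)) x > 0"
      using elim by (intro exI[of _ y]) simp
    have "routed_sum (killing_weight (Q(y := ennreal e))) x y = routed_sum (killing_weight Q) x y"
      using assms(2) by (intro routed_sum_cong killing_weight_upd) auto
    then show ?case
      using prob_root_diff[of "Q(y := ennreal e)" y x] pos elim by simp
  qed
  ultimately have "((\<lambda>e. 1 / e *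
      (\<P>(\<phi> in forest_law w (Q(y := ennreal e)). roots \<phi> \<inter> tree_of \<phi> x = {y}) -
        \<P>(\<phi> in forest_law w (Q(y := ennreal e)). roots \<phi> = {y}))) \<longlongrightarrow>
      routed_sum (killing_weight Q) x y / partition_function w Q) (at_right 0)"
    by (rule Lim_transform_eventually)
  then show ?thesis
    unfolding zero_rate_term_def by (intro tendsto_Lim trivial_limit_at_right_real)
qed

lemma root_term_eq:
  assumes "\<exists>x. Q x > 0"
  shows "(if Q y = 0 then zero_rate_term w Q x y
      else enn2real (1 / Q y) *
        (\<P>(\<phi> in forest_law w Q. roots \<phi> \<inter> tree_of \<phi> x = {y}) - \<P>(\<phi> in forest_law w Q. roots \<phi> = {y}))) =
    routed_sum (killing_weight Q) x y / partition_function w Q"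
proof -
  consider "Q y = 0" | "Q y = \<infinity>" | q where "0 < q" "Q y = ennreal q"
    by (cases "Q y") (auto simp: order_le_less)
  then show ?thesis
  proof cases
    case 1
    with assms show ?thesis
      by (simp add: zero_rate_term_eq)
  next
    case 2
    then have "routed_sum (killing_weight Q) x y = 0"
      unfolding routed_sum_def by (intro sum.neutral) (simp add: killing_weight_infinite)
    with 2 show ?thesis
      by simp
  next
    case (3 q)
    have "1 / Q y = ennreal (1 / q)"
      using 3 divide_ennreal[of 1 q] by simp
    then have "enn2real (1 / Q y) = 1 / q"
      using 3 by simp
    moreover have "Q y \<noteq> 0" "Q y \<noteq> \<infinity>" "enn2real (Q y) = q"
      using 3 by (simp_all add: ennreal_eq_0_iff)
    ultimately show ?thesis
      using prob_root_diff[OF assms, of y x] 3(1) by simp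
  qed
qed

lemma forest_coeff_eq:
  "(\<Sum>f\<in>{f. forest_fun f}. fun_weight w f * q ^ card (fixed_points f) * of_bool (card (fixed_points f) = k)) =
    q ^ k * forest_coeff w k"
  unfolding forest_coeff_def sum_distrib_left by (rule sum.mono_neutral_cong_right) auto

lemma prob_card_roots:
  assumes "0 < q"
  shows "\<P>(\<phi> in forest_law w (\<lambda>_. ennreal q). card (roots \<phi>) = k) =
    q ^ k * forest_coeff w k / partition_function w (\<lambda>_. ennreal q)"
  using assms measure_forest_law[of "\<lambda>_. ennreal q" "\<lambda>\<phi>. card (roots \<phi>) = k"]
  by (simp add: roots_edge_set killing_weight_const forest_coeff_eq)

lemma partition_function_charpoly:
  assumes "0 < q"
  shows "partition_function w (\<lambda>_. ennreal q) = poly (charpoly (gen_matrix w)) q"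
  using assms by (simp add: partition_function_eq killing_weight_const poly_charpoly det_resolvent)

lemma forest_coeff_pos:
  assumes "1 \<le> k" "k \<le> CARD('a)"
  shows "0 < forest_coeff w k"
proof -
  obtain R :: "'a set" where R: "card R = k"
    using obtain_subset_with_card_n[OF assms(2)] by blast
  then have "R \<noteq> {}"
    using assms(1) by auto
  then have "0 < rooted_weight w R"
    using rooted_weight_pos[of w R] rates irred by blast
  also have "\<dots> \<le> forest_coeff w k"
    unfolding rooted_weight_def forest_coeff_def
    using R by (intro sum_mono2 fun_weight_nonneg rates) (auto simp: forests_rooted_def)
  finally show ?thesis .
qed

lemma sum_routed_sum_power:
  assumes "0 < q"
  shows "(\<Sum>y\<in>UNIV. routed_sum (\<lambda>R. q ^ card R) x y) =
    1 / q * (partition_function w (\<lambda>_. ennreal q) - q * forest_coeff w 1)"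
proof -
  have card: "card (fixed_points f - {root_of f x}) + 1 = card (fixed_points f)" if "forest_fun f" for f
    using root_of_in_fixed_points[OF that, of x] card_Suc_Diff1[of "fixed_points f" "root_of f x"] by simp
  have "q * (\<Sum>y\<in>UNIV. routed_sum (\<lambda>R. q ^ card R) x y) =
      (\<Sum>f\<in>{f. forest_fun f \<and> card (fixed_points f) \<noteq> 1}. fun_weight w f * q ^ card (fixed_points f))"
    unfolding sum_routed_sum sum_distrib_left
    by (intro sum.cong refl) (auto simp flip: card)
  also have "\<dots> = (\<Sum>f\<in>{f. forest_fun f}. fun_weight w f * q ^ card (fixed_points f) -
      fun_weight w f * q ^ card (fixed_points f) * of_bool (card (fixed_points f) = 1))"
    by (rule sum.mono_neutral_cong_left) auto
  also have "\<dots> = partition_function w (\<lambda>_. ennreal q) - q * forest_coeff w 1"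
    using assms by (simp only: sum_subtractf forest_coeff_eq)
      (simp add: partition_function_eq killing_weight_const)
  finally show ?thesis
    using assms by (simp add: field_simps)
qed

lemma sum_routed_sum_card:
  assumes "1 \<le> m"
  shows "(\<Sum>y\<in>UNIV. routed_sum (\<lambda>R. of_bool (card R = m)) x y) = forest_coeff w (m + 1)"
proof -
  have card: "card (fixed_points f - {root_of f x}) = card (fixed_points f) - 1" if "forest_fun f" for f
    using root_of_in_fixed_points[OF that, of x] by simp
  show ?thesis
    unfolding sum_routed_sum forest_coeff_def
    by (rule sum.mono_neutral_cong_right) (use assms card in auto)
qed

lemma routed_sum_nonneg: "(\<And>R. 0 \<le> c R) \<Longrightarrow> 0 \<le> routed_sum c x y"
  unfolding routed_sum_def by (intro sum_nonneg mult_nonneg_nonneg fun_weight_nonneg rates) auto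

lemma ratio_card_roots:
  assumes "0 < q"
  shows "\<P>(\<phi> in forest_law w (\<lambda>_. ennreal q). card (roots \<phi>) = m + 1) /
      (q * \<P>(\<phi> in forest_law w (\<lambda>_. ennreal q). card (roots \<phi>) = m)) =
    forest_coeff w (m + 1) / forest_coeff w m"
proof -
  have "partition_function w (\<lambda>_. ennreal q) \<noteq> 0"
    using partition_function_pos[of "\<lambda>_. ennreal q"] assms by simp
  then show ?thesis
    using assms by (simp add: prob_card_roots)
qed

context
  fixes P :: "'a \<Rightarrow> 'w measure" and X :: "real \<Rightarrow> 'w \<Rightarrow> 'a"
  assumes process: "\<And>x. markov_process_from w x (P x) X"
begin

lemma mean_hitting_time_roots:
  assumes "forest_fun f"
  shows "mean_hitting_time (P x) X (roots (edge_set f)) = ennreal (forest_hitting w (roots (edge_set f)) x)"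
proof (rule mean_hitting_time_eq[OF process])
  have "rooted_weight w (roots (edge_set f)) \<noteq> 0"
    using rooted_weight_pos[of w "fixed_points f"] rates irred fixed_points_nonempty[OF assms]
    unfolding roots_edge_set by force
  then show "(\<Sum>z\<in>UNIV. w x z * (forest_hitting w (roots (edge_set f)) z -
      forest_hitting w (roots (edge_set f)) x)) = - 1" if "x \<notin> roots (edge_set f)" for x
    by (rule forest_hitting_poisson[OF that])
qed (auto intro: forest_hitting_nonneg rates forest_hitting_root)

lemma expected_mean_hitting_time:
  assumes "\<exists>x. Q x > 0"
  shows "(\<integral>\<^sup>+ \<phi>. mean_hitting_time (P x) X (roots \<phi>) \<partial>forest_law w Q) =
    ennreal ((\<Sum>y\<in>UNIV. routed_sum (killing_weight Q) x y) / partition_function w Q)"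
proof -
  have "(\<integral>\<^sup>+ \<phi>. mean_hitting_time (P x) X (roots \<phi>) \<partial>forest_law w Q) =
      ennreal ((\<Sum>f\<in>{f. forest_fun f}. fun_weight w f * killing_weight Q (fixed_points f) *
        forest_hitting w (roots (edge_set f)) x) / partition_function w Q)"
    by (rule nn_integral_forest_law[where r = "\<lambda>\<phi>. forest_hitting w (roots \<phi>) x", OF assms])
      (auto intro: forest_hitting_nonneg rates mean_hitting_time_roots)
  then show ?thesis
    unfolding roots_edge_set sum_forest_hitting .
qed

lemma mean_hitting_time_formula:
  assumes "\<exists>x. Q x > 0"
  shows "enn2ereal (\<integral>\<^sup>+ \<phi>. mean_hitting_time (P x) X (roots \<phi>) \<partial>forest_law w Q) =
    ereal (\<Sum>y\<in>UNIV. if Q y = 0 then zero_rate_term w Q x y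
      else enn2real (1 / Q y) *
        (\<P>(\<phi> in forest_law w Q. roots \<phi> \<inter> tree_of \<phi> x = {y}) - \<P>(\<phi> in forest_law w Q. roots \<phi> = {y})))"
proof -
  have "0 \<le> (\<Sum>y\<in>UNIV. routed_sum (killing_weight Q) x y) / partition_function w Q"
    using partition_function_pos[OF assms]
    by (intro divide_nonneg_pos sum_nonneg routed_sum_nonneg killing_weight_nonneg)
  then show ?thesis
    unfolding expected_mean_hitting_time[OF assms] root_term_eq[OF assms]
    by (simp add: sum_divide_distrib)
qed

lemma mean_hitting_time_const:
  assumes "0 < q"
  shows "enn2ereal (\<integral>\<^sup>+ \<phi>. mean_hitting_time (P x) X (roots \<phi>) \<partial>forest_law w (\<lambda>_. ennreal q)) =
    ereal (1 / q * (1 - \<P>(\<phi> in forest_law w (\<lambda>_. ennreal q). card (roots \<phi>) = 1)))"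
proof -
  have pos: "\<exists>x. (\<lambda>_. ennreal q) x > 0"
    using assms by simp
  have Z: "0 < partition_function w (\<lambda>_. ennreal q)"
    by (rule partition_function_pos[OF pos])
  have "killing_weight (\<lambda>_. ennreal q) = (\<lambda>R :: 'a set. q ^ card R)"
    using killing_weight_const[OF assms] by blast
  then have eq: "(\<Sum>y\<in>UNIV. routed_sum (killing_weight (\<lambda>_. ennreal q)) x y) / partition_function w (\<lambda>_. ennreal q) =
      1 / q * (1 - \<P>(\<phi> in forest_law w (\<lambda>_. ennreal q). card (roots \<phi>) = 1))"
    using Z assms by (simp add: sum_routed_sum_power prob_card_roots field_simps)
  have "0 \<le> (\<Sum>y\<in>UNIV. routed_sum (killing_weight (\<lambda>_. ennreal q)) x y) / partition_function w (\<lambda>_. ennreal q)"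
    using Z by (intro divide_nonneg_pos sum_nonneg routed_sum_nonneg killing_weight_nonneg)
  then show ?thesis
    unfolding expected_mean_hitting_time[OF pos] eq by (rule enn2ereal_ennreal)
qed

lemma mean_hitting_time_conditional:
  assumes "0 < q" "1 \<le> m" "m < CARD('a)"
  shows "enn2ereal (\<integral>\<^sup>+ \<phi>. mean_hitting_time (P x) X (roots \<phi>)
      \<partial>uniform_measure (forest_law w (\<lambda>_. ennreal q)) {\<phi> \<in> forests w. card (roots \<phi>) = m}) =
    ereal (forest_coeff w (m + 1) / forest_coeff w m)"
proof -
  define M where "M = forest_law w (\<lambda>_. ennreal q)"
  define A where "A = {\<phi> \<in> forests w. card (roots \<phi>) = m}"
  define Z where "Z = partition_function w (\<lambda>_. ennreal q)"
  have pos: "\<exists>x. (\<lambda>_. ennreal q) x > 0"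
    using assms by simp
  have Z: "0 < Z"
    unfolding Z_def by (rule partition_function_pos[OF pos])
  have a: "0 < forest_coeff w m" "0 < forest_coeff w (m + 1)"
    using assms by (auto intro: forest_coeff_pos)
  have meas: "g \<in> borel_measurable M" for g :: "_ \<Rightarrow> ennreal"
    by (simp add: M_def forest_law_def)
  have A: "A \<in> sets M"
    by (auto simp: A_def M_def forest_law_def sets_point_measure)
  have fin: "emeasure M A \<noteq> \<infinity>"
    by (auto simp: M_def A_def forest_law_def emeasure_point_measure_finite)
  have "emeasure M A = ennreal (\<P>(\<phi> in M. card (roots \<phi>) = m))"
    using fin by (simp add: emeasure_eq_ennreal_measure A_def M_def forest_law_def space_point_measure)
  then have EA: "emeasure M A = ennreal (q ^ m * forest_coeff w m / Z)"
    using assms by (simp add: M_def prob_card_roots Z_def)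
  have "(\<integral>\<^sup>+ \<phi>. mean_hitting_time (P x) X (roots \<phi>) * indicator A \<phi> \<partial>M) =
      (\<integral>\<^sup>+ \<phi>. mean_hitting_time (P x) X (roots \<phi>) * indicator {\<phi>. card (roots \<phi>) = m} \<phi> \<partial>M)"
    by (intro nn_integral_cong)
      (auto simp: A_def M_def forest_law_def space_point_measure indicator_def)
  also have "\<dots> = ennreal ((\<Sum>f\<in>{f. forest_fun f}. fun_weight w f *
      killing_weight (\<lambda>_. ennreal q) (fixed_points f) *
      (forest_hitting w (roots (edge_set f)) x * of_bool (card (roots (edge_set f)) = m))) / Z)"
    unfolding M_def Z_def
    by (rule nn_integral_forest_law[where r = "\<lambda>\<phi>. forest_hitting w (roots \<phi>) x * of_bool (card (roots \<phi>) = m)",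
          OF pos])
      (auto simp: mean_hitting_time_roots indicator_def intro!: forest_hitting_nonneg rates)
  also have "(\<Sum>f\<in>{f. forest_fun f}. fun_weight w f * killing_weight (\<lambda>_. ennreal q) (fixed_points f) *
      (forest_hitting w (roots (edge_set f)) x * of_bool (card (roots (edge_set f)) = m))) =
      q ^ m * (\<Sum>f\<in>{f. forest_fun f}. fun_weight w f * of_bool (card (fixed_points f) = m) *
        forest_hitting w (fixed_points f) x)"
    unfolding sum_distrib_left using assms
    by (intro sum.cong refl) (auto simp: killing_weight_const roots_edge_set)
  also have "\<dots> = q ^ m * forest_coeff w (m + 1)"
    using sum_forest_hitting[of "\<lambda>R. of_bool (card R = m)" x] sum_routed_sum_card[OF assms(2), of x] by simp
  finally have EH: "(\<integral>\<^sup>+ \<phi>. mean_hitting_time (P x) X (roots \<phi>) * indicator A \<phi> \<partial>M) =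
      ennreal (q ^ m * forest_coeff w (m + 1) / Z)" .
  have "(\<integral>\<^sup>+ \<phi>. mean_hitting_time (P x) X (roots \<phi>) \<partial>uniform_measure M A) =
      ennreal (q ^ m * forest_coeff w (m + 1) / Z) / ennreal (q ^ m * forest_coeff w m / Z)"
    using nn_integral_uniform_measure[OF meas A] EH EA by simp
  also have "\<dots> = ennreal (forest_coeff w (m + 1) / forest_coeff w m)"
    using Z a assms by (subst divide_ennreal) auto
  finally show ?thesis
    unfolding M_def A_def using a by simp
qed

end

end

theorem theorem3:
  fixes w :: "'a::finite \<Rightarrow> 'a \<Rightarrow> real"
    and P :: "'a \<Rightarrow> 'w measure" and X :: "real \<Rightarrow> 'w \<Rightarrow> 'a"
  assumes rates: "\<And>x y. 0 \<le> w x y"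
    and irred: "irreducible_rates w"
    and process: "\<And>x. markov_process_from w x (P x) X"
  shows
    "(\<forall>Q :: 'a \<Rightarrow> ennreal. (\<exists>x. Q x > 0) \<longrightarrow>
       (\<forall>x. enn2ereal (\<integral>\<^sup>+ \<phi>. mean_hitting_time (P x) X (roots \<phi>) \<partial>forest_law w Q) =
         ereal (\<Sum>y\<in>UNIV.
           if Q y = 0 then zero_rate_term w Q x y
           else enn2real (1 / Q y) *
             (\<P>(\<phi> in forest_law w Q. roots \<phi> \<inter> tree_of \<phi> x = {y}) -
              \<P>(\<phi> in forest_law w Q. roots \<phi> = {y})))))
     \<and>
     (\<forall>q :: real. q > 0 \<longrightarrow>
       (\<forall>x. enn2ereal (\<integral>\<^sup>+ \<phi>. mean_hitting_time (P x) X (roots \<phi>) \<partial>forest_law w (\<lambda>_. ennreal q)) =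
         ereal (1 / q * (1 - \<P>(\<phi> in forest_law w (\<lambda>_. ennreal q). card (roots \<phi>) = 1)))) \<and>
       (\<forall>lam. eigenvalue_enum (map_matrix complex_of_real (- gen_matrix w)) lam \<longrightarrow> lam 0 = 0 \<longrightarrow>
         (\<forall>i j. i \<le> j \<and> j < CARD('a) \<longrightarrow> Re (lam i) \<le> Re (lam j)) \<longrightarrow>
         complex_of_real (1 / q * (1 - \<P>(\<phi> in forest_law w (\<lambda>_. ennreal q). card (roots \<phi>) = 1))) =
           1 / of_real q * (1 - (\<Prod>i=1..CARD('a) - 1. lam i / (of_real q + lam i)))))
     \<and>
     (charpoly (gen_matrix w) =
        (\<Sum>k=1..CARD('a). monom (coeff (charpoly (gen_matrix w)) k) k) \<and>
      coeff (charpoly (gen_matrix w)) CARD('a) = 1)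
     \<and>
     (\<forall>(q :: real) m x. q > 0 \<longrightarrow> 1 \<le> m \<longrightarrow> m < CARD('a) \<longrightarrow>
       enn2ereal (\<integral>\<^sup>+ \<phi>. mean_hitting_time (P x) X (roots \<phi>)
           \<partial>uniform_measure (forest_law w (\<lambda>_. ennreal q)) {\<phi> \<in> forests w. card (roots \<phi>) = m}) =
         ereal (\<P>(\<phi> in forest_law w (\<lambda>_. ennreal q). card (roots \<phi>) = m + 1) /
                (q * \<P>(\<phi> in forest_law w (\<lambda>_. ennreal q). card (roots \<phi>) = m))) \<and>
       \<P>(\<phi> in forest_law w (\<lambda>_. ennreal q). card (roots \<phi>) = m + 1) /
           (q * \<P>(\<phi> in forest_law w (\<lambda>_. ennreal q). card (roots \<phi>) = m)) =
         coeff (charpoly (gen_matrix w)) (m + 1) / coeff (charpoly (gen_matrix w)) m)"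
proof (intro conjI allI impI, goal_cases)
  case (1 Q x)
  then show ?case
    by (rule mean_hitting_time_formula[OF rates irred process])
next
  case (2 q x)
  then show ?case
    by (rule mean_hitting_time_const[OF rates irred process])
next
  case (3 q lam)
  have Z: "0 < poly (charpoly (gen_matrix w)) q"
    using partition_function_pos[OF rates irred, of "\<lambda>_. ennreal q"]
      partition_function_charpoly[OF rates irred 3(1)] 3(1) by simp
  have "(\<Prod>i=1..CARD('a) - 1. lam i / (of_real q + lam i)) =
      of_real (\<P>(\<phi> in forest_law w (\<lambda>_. ennreal q). card (roots \<phi>) = 1))"
    using prod_eigenvalues[OF 3(2,3), of q] Z
    by (simp add: prob_card_roots[OF rates irred 3(1)] partition_function_charpoly[OF rates irred 3(1)])
  then show ?case
    by simp
next
  case 4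
  show ?case
    by (rule charpoly_gen_matrix_expansion)
next
  case 5
  show ?case
    by (simp add: coeff_charpoly_gen_matrix forest_coeff_CARD)
next
  case (6 q m x)
  then show ?case
    by (simp only: ratio_card_roots[OF rates irred] mean_hitting_time_conditional[OF rates irred process])
next
  case (7 q m x)
  then show ?case
    by (simp only: ratio_card_roots[OF rates irred] coeff_charpoly_gen_matrix)
qed

end
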